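(* Let $G$ be a group and $M$ a left $K_{\mathrm{par}}(G)$-module. Then $H^1_{par}(G,M)$ is isomorphic to the quotient of the additive group of $$\mathrm D(G,M)=\{d:G\to M\mid\forall g,h\in G:\ e_g\cdot d(gh)=[g]\cdot d(h)+e_{gh}\cdot d(g)\}$$ modulo the subgroup $$\mathrm{PD}(G,M)=\{d:G\to M\mid\exists m\in M\ \forall g\in G:\ d(g)=[g]\cdot m-e_g\cdot m\}.$$
   Context: $K$ is a commutative unital ring. $\mathcal S(G)$ is the monoid generated by symbols $[g]$, $g\in G$, with relations $[g^{-1}][g][h]=[g^{-1}][gh]$, $[g][h][h^{-1}]=[gh][h^{-1}]$, $[g][1_G]=[g]$ (so $[1_G]$ is the identity). It is an inverse monoid; $s^{-1}$ denotes the inverse of $s$ and $E(\mathcal S(G))$ the semilattice of idempotents. $e_g=[g][g^{-1}]$. $K_{\mathrm{par}}(G)=K\mathcal S(G)$ is the semigroup algebra (partial group algebra). $B=KE(\mathcal S(G))$ is the left $K_{\mathrm{par}}(G)$-module with $s\cdot e=ses^{-1}$ for $s\in\mathcal S(G)$, $e\in E(\mathcal S(G))$. The cohomology of Alvares, Alves and Redondo is $H^n_{par}(G,M)=\mathrm{Ext}^n_{K_{\mathrm{par}}(G)}(B,M)$. *)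

theory Defs
  imports "HOL-Algebra.Coset" "HOL-Algebra.Module"
begin

section \<open>Left modules over a not necessarily commutative ring\<close>

text \<open>The locale \<open>module\<close> of HOL-Algebra requires a commutative ring of scalars.\<close>

locale left_module = R?: ring R + M?: abelian_group M
    for R :: "('r, 'x) ring_scheme" (structure) and M :: "('r, 'm, 'y) module_scheme" (structure) +
  assumes smult_closed:
      "\<lbrakk>a \<in> carrier R; x \<in> carrier M\<rbrakk> \<Longrightarrow> a \<odot>\<^bsub>M\<^esub> x \<in> carrier M"
    and smult_l_distr:
      "\<lbrakk>a \<in> carrier R; b \<in> carrier R; x \<in> carrier M\<rbrakk> \<Longrightarrow>
        (a \<oplus>\<^bsub>R\<^esub> b) \<odot>\<^bsub>M\<^esub> x = a \<odot>\<^bsub>M\<^esub> x \<oplus>\<^bsub>M\<^esub> b \<odot>\<^bsub>M\<^esub> x"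
    and smult_r_distr:
      "\<lbrakk>a \<in> carrier R; x \<in> carrier M; y \<in> carrier M\<rbrakk> \<Longrightarrow>
        a \<odot>\<^bsub>M\<^esub> (x \<oplus>\<^bsub>M\<^esub> y) = a \<odot>\<^bsub>M\<^esub> x \<oplus>\<^bsub>M\<^esub> a \<odot>\<^bsub>M\<^esub> y"
    and smult_assoc:
      "\<lbrakk>a \<in> carrier R; b \<in> carrier R; x \<in> carrier M\<rbrakk> \<Longrightarrow>
        (a \<otimes>\<^bsub>R\<^esub> b) \<odot>\<^bsub>M\<^esub> x = a \<odot>\<^bsub>M\<^esub> (b \<odot>\<^bsub>M\<^esub> x)"
    and smult_one:
      "x \<in> carrier M \<Longrightarrow> \<one>\<^bsub>R\<^esub> \<odot>\<^bsub>M\<^esub> x = x"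

definition lmod_hom ::
    "('r, 'x) ring_scheme \<Rightarrow> ('r, 'm, 'y) module_scheme \<Rightarrow> ('r, 'n, 'z) module_scheme \<Rightarrow> ('m \<Rightarrow> 'n) set"
  where "lmod_hom R M N =
    {f. f \<in> carrier M \<rightarrow> carrier N \<and>
        (\<forall>x\<in>carrier M. \<forall>y\<in>carrier M. f (x \<oplus>\<^bsub>M\<^esub> y) = f x \<oplus>\<^bsub>N\<^esub> f y) \<and>
        (\<forall>a\<in>carrier R. \<forall>x\<in>carrier M. f (a \<odot>\<^bsub>M\<^esub> x) = a \<odot>\<^bsub>N\<^esub> f x)}"

text \<open>
  Projectivity is the lifting property. A definition in HOL cannot quantify over types, so the
  test modules are taken in the types \<open>'p \<Rightarrow> 'r\<close> and \<open>'p\<close>. These types are large enough: they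
  contain the canonical surjection onto \<open>P\<close> from the free module on the set \<open>carrier P\<close>
  (finitely supported functions), so a module with this restricted property is a direct summand
  of a free module, and therefore lifts against all surjections.
\<close>

definition projective_lmod :: "('r, 'x) ring_scheme \<Rightarrow> ('r, 'p) module \<Rightarrow> bool"
  where "projective_lmod R P \<longleftrightarrow>
    left_module R P \<and>
    (\<forall>(N :: ('r, 'p \<Rightarrow> 'r) module) (L :: ('r, 'p) module) f g.
       left_module R N \<and> left_module R L \<and>
       f \<in> lmod_hom R N L \<and> f ` carrier N = carrier L \<and> g \<in> lmod_hom R P L \<longrightarrow>
       (\<exists>h\<in>lmod_hom R P N. \<forall>x\<in>carrier P. f (h x) = g x))"

section \<open>Ext groups\<close>

text \<open>
  \<open>\<dots> \<rightarrow> P 2 \<rightarrow> P 1 \<rightarrow> P 0 \<rightarrow> N \<rightarrow> 0\<close> with differentials \<open>d n : P (n + 1) \<rightarrow> P n\<close> and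
  augmentation \<open>eps : P 0 \<rightarrow> N\<close>.
\<close>

definition projective_resolution ::
    "('r, 'x) ring_scheme \<Rightarrow> ('r, 'n) module \<Rightarrow>
     (nat \<Rightarrow> ('r, 'p) module) \<Rightarrow> (nat \<Rightarrow> 'p \<Rightarrow> 'p) \<Rightarrow> ('p \<Rightarrow> 'n) \<Rightarrow> bool"
  where "projective_resolution R N P d eps \<longleftrightarrow>
    (\<forall>n. projective_lmod R (P n)) \<and>
    (\<forall>n. d n \<in> lmod_hom R (P (Suc n)) (P n)) \<and>
    eps \<in> lmod_hom R (P 0) N \<and>
    eps ` carrier (P 0) = carrier N \<and>
    d 0 ` carrier (P 1) = {x \<in> carrier (P 0). eps x = \<zero>\<^bsub>N\<^esub>} \<and>
    (\<forall>n. d (Suc n) ` carrier (P (Suc (Suc n))) = {x \<in> carrier (P (Suc n)). d n x = \<zero>\<^bsub>P n\<^esub>})"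

text \<open>
  Groups of maps under pointwise addition are written multiplicatively, i.e. as \<open>monoid\<close> records,
  so that \<open>Mod\<close> and \<open>\<cong>\<close> apply to them. Maps are \<open>undefined\<close> outside their domain,
  which makes equality of maps equality on the domain.
\<close>

definition pointwise_group :: "'a set \<Rightarrow> ('m, 'y) ring_scheme \<Rightarrow> ('a \<Rightarrow> 'm) set \<Rightarrow> ('a \<Rightarrow> 'm) monoid"
  where "pointwise_group X M F =
    \<lparr>carrier = F, monoid.mult = (\<lambda>f g. \<lambda>x\<in>X. f x \<oplus>\<^bsub>M\<^esub> g x), one = (\<lambda>x\<in>X. \<zero>\<^bsub>M\<^esub>)\<rparr>"

definition cochains ::
    "('r, 'x) ring_scheme \<Rightarrow> (nat \<Rightarrow> ('r, 'p) module) \<Rightarrow> ('r, 'm) module \<Rightarrow> nat \<Rightarrow> ('p \<Rightarrow> 'm) set"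
  where "cochains R P M n = lmod_hom R (P n) M \<inter> extensional (carrier (P n))"

definition coboundary ::
    "(nat \<Rightarrow> ('r, 'p) module) \<Rightarrow> (nat \<Rightarrow> 'p \<Rightarrow> 'p) \<Rightarrow> nat \<Rightarrow> ('p \<Rightarrow> 'm) \<Rightarrow> ('p \<Rightarrow> 'm)"
  where "coboundary P d n f = (\<lambda>x\<in>carrier (P (Suc n)). f (d n x))"

definition ext_cocycles ::
    "('r, 'x) ring_scheme \<Rightarrow> (nat \<Rightarrow> ('r, 'p) module) \<Rightarrow> (nat \<Rightarrow> 'p \<Rightarrow> 'p) \<Rightarrow>
     ('r, 'm) module \<Rightarrow> nat \<Rightarrow> ('p \<Rightarrow> 'm) set"
  where "ext_cocycles R P d M n =
    {f \<in> cochains R P M n. coboundary P d n f = (\<lambda>x\<in>carrier (P (Suc n)). \<zero>\<^bsub>M\<^esub>)}"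

fun ext_coboundaries ::
    "('r, 'x) ring_scheme \<Rightarrow> (nat \<Rightarrow> ('r, 'p) module) \<Rightarrow> (nat \<Rightarrow> 'p \<Rightarrow> 'p) \<Rightarrow>
     ('r, 'm) module \<Rightarrow> nat \<Rightarrow> ('p \<Rightarrow> 'm) set"
  where
    "ext_coboundaries R P d M 0 = {\<lambda>x\<in>carrier (P 0). \<zero>\<^bsub>M\<^esub>}"
  | "ext_coboundaries R P d M (Suc n) = coboundary P d n ` cochains R P M n"

text \<open>
  The \<open>n\<close>-th cohomology group of the complex \<open>Hom\<^bsub>R\<^esub>(P, M)\<close>; this is \<open>Ext\<^sup>n(N, M)\<close>
  whenever \<open>(P, d, eps)\<close> is a projective resolution of \<open>N\<close>.
\<close>

definition Ext ::
    "('r, 'x) ring_scheme \<Rightarrow> (nat \<Rightarrow> ('r, 'p) module) \<Rightarrow> (nat \<Rightarrow> 'p \<Rightarrow> 'p) \<Rightarrow>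
     ('r, 'm) module \<Rightarrow> nat \<Rightarrow> ('p \<Rightarrow> 'm) set monoid"
  where "Ext R P d M n =
    pointwise_group (carrier (P n)) M (ext_cocycles R P d M n) Mod ext_coboundaries R P d M n"

section \<open>The monoid S(G)\<close>

text \<open>
  Words are nonempty lists of elements of \<open>G\<close>: the relation \<open>[g][1] = [g]\<close> makes \<open>[1]\<close> the
  identity of the semigroup (not merely monoid) with this presentation, since
  \<open>[1][g] = [g g\<^sup>-\<^sup>1][g] = [g][g\<^sup>-\<^sup>1][g] = [g][1] = [g]\<close>. If the empty word were admitted,
  it would be equal to no other word.
\<close>

inductive par_eq :: "('g, 'b) monoid_scheme \<Rightarrow> 'g list \<Rightarrow> 'g list \<Rightarrow> bool" for G (structure)
  where
    rel_left: "\<lbrakk>g \<in> carrier G; h \<in> carrier G\<rbrakk> \<Longrightarrow> par_eq G [inv g, g, h] [inv g, g \<otimes> h]"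
  | rel_right: "\<lbrakk>g \<in> carrier G; h \<in> carrier G\<rbrakk> \<Longrightarrow> par_eq G [g, h, inv h] [g \<otimes> h, inv h]"
  | rel_one: "g \<in> carrier G \<Longrightarrow> par_eq G [g, \<one>] [g]"
  | refl: "\<lbrakk>u \<in> lists (carrier G); u \<noteq> []\<rbrakk> \<Longrightarrow> par_eq G u u"
  | sym: "par_eq G u v \<Longrightarrow> par_eq G v u"
  | trans: "\<lbrakk>par_eq G u v; par_eq G v w\<rbrakk> \<Longrightarrow> par_eq G u w"
  | cong: "\<lbrakk>par_eq G u u'; par_eq G v v'\<rbrakk> \<Longrightarrow> par_eq G (u @ v) (u' @ v')"

definition par_class :: "('g, 'b) monoid_scheme \<Rightarrow> 'g list \<Rightarrow> 'g list set"
  where "par_class G u = {v. par_eq G u v}"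

abbreviation par_gen :: "('g, 'b) monoid_scheme \<Rightarrow> 'g \<Rightarrow> 'g list set"
  where "par_gen G g \<equiv> par_class G [g]"

definition par_monoid :: "('g, 'b) monoid_scheme \<Rightarrow> 'g list set monoid"
  where "par_monoid G =
    \<lparr>carrier = par_class G ` (lists (carrier G) - {[]}),
     monoid.mult = (\<lambda>X Y. {w. \<exists>u\<in>X. \<exists>v\<in>Y. par_eq G (u @ v) w}),
     one = par_gen G \<one>\<^bsub>G\<^esub>\<rparr>"

definition par_e :: "('g, 'b) monoid_scheme \<Rightarrow> 'g \<Rightarrow> 'g list set"
  where "par_e G g = par_gen G g \<otimes>\<^bsub>par_monoid G\<^esub> par_gen G (inv\<^bsub>G\<^esub> g)"

text \<open>The inverse in the sense of inverse semigroups; \<open>m_inv\<close> is the group inverse.\<close>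

definition semigroup_inv :: "('s, 'c) monoid_scheme \<Rightarrow> 's \<Rightarrow> 's"
  where "semigroup_inv S s =
    (THE t. t \<in> carrier S \<and> s \<otimes>\<^bsub>S\<^esub> t \<otimes>\<^bsub>S\<^esub> s = s \<and> t \<otimes>\<^bsub>S\<^esub> s \<otimes>\<^bsub>S\<^esub> t = t)"

definition idempotents :: "('s, 'c) monoid_scheme \<Rightarrow> 's set"
  where "idempotents S = {e \<in> carrier S. e \<otimes>\<^bsub>S\<^esub> e = e}"

section \<open>The partial group algebra and the module B\<close>

definition fin_supp_funs :: "('k, 'a) ring_scheme \<Rightarrow> 's set \<Rightarrow> ('s \<Rightarrow> 'k) set"
  where "fin_supp_funs K X =
    {f. f \<in> X \<rightarrow> carrier K \<and> (\<forall>x. x \<notin> X \<longrightarrow> f x = \<zero>\<^bsub>K\<^esub>) \<and> finite {x. f x \<noteq> \<zero>\<^bsub>K\<^esub>}}"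

text \<open>
  The bilinear extension of \<open>op\<close>:
  \<open>(\<Sum>\<^sub>x a\<^sub>x x) (\<Sum>\<^sub>y b\<^sub>y y) = \<Sum>\<^sub>x\<^sub>,\<^sub>y a\<^sub>x b\<^sub>y (op x y)\<close>.
\<close>

definition bilinear_ext ::
    "('k, 'a) ring_scheme \<Rightarrow> ('s \<Rightarrow> 't \<Rightarrow> 'u) \<Rightarrow> ('s \<Rightarrow> 'k) \<Rightarrow> ('t \<Rightarrow> 'k) \<Rightarrow> 'u \<Rightarrow> 'k"
  where "bilinear_ext K op a b z =
    (\<Oplus>\<^bsub>K\<^esub>p\<in>{(x, y). a x \<noteq> \<zero>\<^bsub>K\<^esub> \<and> b y \<noteq> \<zero>\<^bsub>K\<^esub> \<and> op x y = z}. a (fst p) \<otimes>\<^bsub>K\<^esub> b (snd p))"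

definition alg_basis :: "('k, 'a) ring_scheme \<Rightarrow> 's \<Rightarrow> 's \<Rightarrow> 'k"
  where "alg_basis K s = (\<lambda>t. if t = s then \<one>\<^bsub>K\<^esub> else \<zero>\<^bsub>K\<^esub>)"

definition monoid_algebra :: "('k, 'a) ring_scheme \<Rightarrow> ('s, 'c) monoid_scheme \<Rightarrow> ('s \<Rightarrow> 'k) ring"
  where "monoid_algebra K S =
    \<lparr>carrier = fin_supp_funs K (carrier S),
     monoid.mult = bilinear_ext K (\<lambda>s t. s \<otimes>\<^bsub>S\<^esub> t),
     one = alg_basis K \<one>\<^bsub>S\<^esub>,
     zero = (\<lambda>_. \<zero>\<^bsub>K\<^esub>),
     add = (\<lambda>a b s. a s \<oplus>\<^bsub>K\<^esub> b s)\<rparr>"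

abbreviation Kpar :: "('k, 'a) ring_scheme \<Rightarrow> ('g, 'b) monoid_scheme \<Rightarrow> ('g list set \<Rightarrow> 'k) ring"
  where "Kpar K G \<equiv> monoid_algebra K (par_monoid G)"

text \<open>
  The scalar action extends \<open>s \<cdot> e = s e s\<^sup>-\<^sup>1\<close> bilinearly. The fields \<open>mult\<close> and \<open>one\<close> of the
  \<open>module\<close> record play no role.
\<close>

definition Kpar_B ::
    "('k, 'a) ring_scheme \<Rightarrow> ('g, 'b) monoid_scheme \<Rightarrow> ('g list set \<Rightarrow> 'k, 'g list set \<Rightarrow> 'k) module"
  where "Kpar_B K G =
    \<lparr>carrier = fin_supp_funs K (idempotents (par_monoid G)),
     monoid.mult = undefined,
     one = undefined,
     zero = (\<lambda>_. \<zero>\<^bsub>K\<^esub>),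
     add = (\<lambda>a b s. a s \<oplus>\<^bsub>K\<^esub> b s),
     smult = bilinear_ext K
       (\<lambda>s e. s \<otimes>\<^bsub>par_monoid G\<^esub> e \<otimes>\<^bsub>par_monoid G\<^esub> semigroup_inv (par_monoid G) s)\<rparr>"

section \<open>Partial derivations\<close>

text \<open>The action of \<open>s \<in> S(G)\<close> on a \<open>K\<^sub>p\<^sub>a\<^sub>r(G)\<close>-module.\<close>

definition par_act :: "('k, 'a) ring_scheme \<Rightarrow> ('s \<Rightarrow> 'k, 'm) module \<Rightarrow> 's \<Rightarrow> 'm \<Rightarrow> 'm"
  where "par_act K M s m = alg_basis K s \<odot>\<^bsub>M\<^esub> m"

definition par_der ::
    "('k, 'a) ring_scheme \<Rightarrow> ('g, 'b) monoid_scheme \<Rightarrow> ('g list set \<Rightarrow> 'k, 'm) module \<Rightarrow> ('g \<Rightarrow> 'm) set"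
  where "par_der K G M =
    {d \<in> carrier G \<rightarrow>\<^sub>E carrier M. \<forall>g\<in>carrier G. \<forall>h\<in>carrier G.
       par_act K M (par_e G g) (d (g \<otimes>\<^bsub>G\<^esub> h)) =
       par_act K M (par_gen G g) (d h) \<oplus>\<^bsub>M\<^esub> par_act K M (par_e G (g \<otimes>\<^bsub>G\<^esub> h)) (d g)}"

definition par_inner_der ::
    "('k, 'a) ring_scheme \<Rightarrow> ('g, 'b) monoid_scheme \<Rightarrow> ('g list set \<Rightarrow> 'k, 'm) module \<Rightarrow> ('g \<Rightarrow> 'm) set"
  where "par_inner_der K G M =
    {d \<in> carrier G \<rightarrow>\<^sub>E carrier M. \<exists>m\<in>carrier M. \<forall>g\<in>carrier G.
       d g = par_act K M (par_gen G g) m \<ominus>\<^bsub>M\<^esub> par_act K M (par_e G g) m}"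

end

theory Submission
  imports Defs
begin

text \<open>
  \<open>B\<close> is cyclic, generated by \<open>1\<close>, with annihilator \<open>I\<close>. For any projective resolution, a lift \<open>p\<close> of
  \<open>1\<close> to \<open>P 0\<close> and a lift \<open>\<beta> : P 0 \<rightarrow> K\<^sub>p\<^sub>a\<^sub>r(G)\<close> of the augmentation give mutually inverse comparison maps
  up to homotopy, so \<open>Ext\<^sup>1(B, M)\<close> is \<open>Hom(I, M)\<close> modulo the maps \<open>a \<mapsto> a \<cdot> m\<close>.

  Every \<open>s\<close> in \<open>S(G)\<close> equals \<open>s s\<^sup>-\<^sup>1 [g]\<close>, where \<open>g\<close> is its image in \<open>G\<close>. Hence \<open>I\<close> is the left ideal generated
  by the elements \<open>[g] - e\<^sub>g\<close>, and a homomorphism on \<open>I\<close> is determined by \<open>d(g) = \<phi>([g] - e\<^sub>g)\<close>, which is a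
  partial derivation. Conversely \<open>s \<mapsto> s s\<^sup>-\<^sup>1 \<cdot> d(g)\<close> extends linearly to the algebra, and on products \<open>t b\<close>
  it fails to commute with \<open>t\<close> only by a term containing \<open>b \<cdot> 1\<close>, which vanishes for \<open>b \<in> I\<close>.
\<close>

section \<open>Modules and quotient groups\<close>

text \<open>The resolution is arbitrary, so no explicit one can be computed with, and projectivity
  may only be tested on modules whose elements lie in \<open>'p \<Rightarrow> 'r\<close> and
  \<open>'p\<close>. It enters through the single lift \<open>\<beta>\<close>; to obtain it, the
  ring and the cyclic module are rebuilt inside these two types. Since \<open>\<beta> p\<close> is
  only congruent to \<open>1\<close> modulo \<open>I\<close>, the comparison with
  \<open>Hom(I, M)\<close> is onto only up to maps \<open>a \<mapsto> a \<cdot> m\<close>; the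
  isomorphisms are therefore proved directly between quotients.

  No ring or module axiom is verified on convolution sums. That the algebra is a ring is contained
  in the hypothesis that \<open>M\<close> is a left module over it, and the module axioms of
  \<open>B\<close> are carried over from \<open>P 0\<close> along the surjection \<open>eps\<close>.

  That \<open>I\<close> is generated by the \<open>[g] - e_g\<close> cannot be proved term by term,
  because the terms of an element of \<open>I\<close> need not lie in \<open>I\<close>. The remedy
  is the additive map \<open>\<pi>\<close> extending \<open>s \<mapsto> s s^-1\<close>: every
  \<open>s - s s^-1\<close> is a left multiple of a generator, and \<open>\<pi>\<close> vanishes on
  \<open>I\<close>.\<close>

context left_module
begin

lemma smult_r_zero [simp]: assumes "a \<in> carrier R" shows "a \<odot>\<^bsub>M\<^esub> \<zero>\<^bsub>M\<^esub> = \<zero>\<^bsub>M\<^esub>"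
proof -
  have "a \<odot>\<^bsub>M\<^esub> \<zero>\<^bsub>M\<^esub> \<oplus>\<^bsub>M\<^esub> a \<odot>\<^bsub>M\<^esub> \<zero>\<^bsub>M\<^esub> = a \<odot>\<^bsub>M\<^esub> \<zero>\<^bsub>M\<^esub>"
    using smult_r_distr[OF assms M.zero_closed M.zero_closed] by simp
  then show ?thesis
    using smult_closed[OF assms M.zero_closed] M.add.r_cancel_one by metis
qed

lemma smult_l_zero [simp]: assumes "x \<in> carrier M" shows "\<zero>\<^bsub>R\<^esub> \<odot>\<^bsub>M\<^esub> x = \<zero>\<^bsub>M\<^esub>"
proof -
  have "\<zero>\<^bsub>R\<^esub> \<odot>\<^bsub>M\<^esub> x \<oplus>\<^bsub>M\<^esub> \<zero>\<^bsub>R\<^esub> \<odot>\<^bsub>M\<^esub> x = \<zero>\<^bsub>R\<^esub> \<odot>\<^bsub>M\<^esub> x"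
    using smult_l_distr[OF R.zero_closed R.zero_closed assms] by simp
  then show ?thesis
    using smult_closed[OF R.zero_closed assms] M.add.r_cancel_one by metis
qed

lemma smult_r_minus:
  assumes "a \<in> carrier R" "x \<in> carrier M"
  shows "a \<odot>\<^bsub>M\<^esub> (\<ominus>\<^bsub>M\<^esub> x) = \<ominus>\<^bsub>M\<^esub> (a \<odot>\<^bsub>M\<^esub> x)"
proof -
  have "a \<odot>\<^bsub>M\<^esub> (\<ominus>\<^bsub>M\<^esub> x) \<oplus>\<^bsub>M\<^esub> a \<odot>\<^bsub>M\<^esub> x = \<zero>\<^bsub>M\<^esub>"
    using assms by (simp add: smult_r_distr[symmetric] M.l_neg)
  then show ?thesis
    using assms by (intro M.minus_equality[symmetric]) (simp_all add: smult_closed)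
qed

lemma smult_l_minus:
  assumes "a \<in> carrier R" "x \<in> carrier M"
  shows "(\<ominus>\<^bsub>R\<^esub> a) \<odot>\<^bsub>M\<^esub> x = \<ominus>\<^bsub>M\<^esub> (a \<odot>\<^bsub>M\<^esub> x)"
proof -
  have "(\<ominus>\<^bsub>R\<^esub> a) \<odot>\<^bsub>M\<^esub> x \<oplus>\<^bsub>M\<^esub> a \<odot>\<^bsub>M\<^esub> x = \<zero>\<^bsub>M\<^esub>"
    using assms by (simp add: smult_l_distr[symmetric] R.l_neg)
  then show ?thesis
    using assms by (intro M.minus_equality[symmetric]) (simp_all add: smult_closed)
qed

lemma smult_l_diff:
  assumes "a \<in> carrier R" "b \<in> carrier R" "x \<in> carrier M"
  shows "(a \<ominus>\<^bsub>R\<^esub> b) \<odot>\<^bsub>M\<^esub> x = a \<odot>\<^bsub>M\<^esub> x \<ominus>\<^bsub>M\<^esub> b \<odot>\<^bsub>M\<^esub> x"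
  using assms by (simp add: a_minus_def smult_l_distr smult_l_minus)

lemma smult_r_diff:
  assumes "a \<in> carrier R" "x \<in> carrier M" "y \<in> carrier M"
  shows "a \<odot>\<^bsub>M\<^esub> (x \<ominus>\<^bsub>M\<^esub> y) = a \<odot>\<^bsub>M\<^esub> x \<ominus>\<^bsub>M\<^esub> a \<odot>\<^bsub>M\<^esub> y"
  using assms by (simp add: a_minus_def smult_r_distr smult_r_minus)

end

lemma lmod_homI:
  assumes "\<And>x. x \<in> carrier M \<Longrightarrow> f x \<in> carrier N"
    and "\<And>x y. \<lbrakk>x \<in> carrier M; y \<in> carrier M\<rbrakk> \<Longrightarrow> f (x \<oplus>\<^bsub>M\<^esub> y) = f x \<oplus>\<^bsub>N\<^esub> f y"
    and "\<And>a x. \<lbrakk>a \<in> carrier R; x \<in> carrier M\<rbrakk> \<Longrightarrow> f (a \<odot>\<^bsub>M\<^esub> x) = a \<odot>\<^bsub>N\<^esub> f x"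
  shows "f \<in> lmod_hom R M N"
  using assms by (simp add: lmod_hom_def)

lemma lmod_hom_closed: "\<lbrakk>f \<in> lmod_hom R M N; x \<in> carrier M\<rbrakk> \<Longrightarrow> f x \<in> carrier N"
  by (auto simp: lmod_hom_def)

lemma lmod_hom_add:
  "\<lbrakk>f \<in> lmod_hom R M N; x \<in> carrier M; y \<in> carrier M\<rbrakk> \<Longrightarrow> f (x \<oplus>\<^bsub>M\<^esub> y) = f x \<oplus>\<^bsub>N\<^esub> f y"
  by (simp add: lmod_hom_def)

lemma lmod_hom_smult:
  "\<lbrakk>f \<in> lmod_hom R M N; a \<in> carrier R; x \<in> carrier M\<rbrakk> \<Longrightarrow> f (a \<odot>\<^bsub>M\<^esub> x) = a \<odot>\<^bsub>N\<^esub> f x"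
  by (simp add: lmod_hom_def)

lemma lmod_hom_zero:
  assumes "left_module R M" "left_module R N" and f: "f \<in> lmod_hom R M N"
  shows "f \<zero>\<^bsub>M\<^esub> = \<zero>\<^bsub>N\<^esub>"
proof -
  interpret M: left_module R M by fact
  interpret N: left_module R N by fact
  have "f (\<zero>\<^bsub>R\<^esub> \<odot>\<^bsub>M\<^esub> \<zero>\<^bsub>M\<^esub>) = \<zero>\<^bsub>R\<^esub> \<odot>\<^bsub>N\<^esub> f \<zero>\<^bsub>M\<^esub>"
    by (rule lmod_hom_smult[OF f]) auto
  then show ?thesis using lmod_hom_closed[OF f M.zero_closed] by simp
qed

lemma lmod_hom_minus:
  assumes "left_module R M" "left_module R N" and f: "f \<in> lmod_hom R M N" and x: "x \<in> carrier M"
  shows "f (\<ominus>\<^bsub>M\<^esub> x) = \<ominus>\<^bsub>N\<^esub> f x"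
proof -
  interpret M: left_module R M by fact
  interpret N: left_module R N by fact
  have "f (\<ominus>\<^bsub>M\<^esub> x) \<oplus>\<^bsub>N\<^esub> f x = f (\<ominus>\<^bsub>M\<^esub> x \<oplus>\<^bsub>M\<^esub> x)"
    using x by (simp add: lmod_hom_add[OF f])
  also have "\<dots> = \<zero>\<^bsub>N\<^esub>"
    using x lmod_hom_zero[OF assms(1,2) f] by (simp add: M.l_neg)
  finally show ?thesis
    using x by (intro N.minus_equality[symmetric]) (auto intro: lmod_hom_closed[OF f])
qed

lemma lmod_hom_diff:
  assumes "left_module R M" "left_module R N" and f: "f \<in> lmod_hom R M N"
    and "x \<in> carrier M" "y \<in> carrier M"
  shows "f (x \<ominus>\<^bsub>M\<^esub> y) = f x \<ominus>\<^bsub>N\<^esub> f y"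
proof -
  interpret M: left_module R M by fact
  show ?thesis
    using assms by (simp add: a_minus_def lmod_hom_add[OF f] lmod_hom_minus)
qed

text \<open>No axiom is assumed for the operations of \<open>L\<close>: each one is an equation in
  \<open>P\<close> pushed forward by \<open>c\<close>. The condition \<open>zero\<close> is separate
  because additivity gives \<open>c 0 = 0\<close> only where cancellation is available.\<close>

lemma left_module_image:
  assumes P: "left_module R P" and c: "c \<in> lmod_hom R P L"
    and im: "c ` carrier P = carrier L" and zero: "c \<zero>\<^bsub>P\<^esub> = \<zero>\<^bsub>L\<^esub>"
  shows "left_module R L"
proof -
  interpret P: left_module R P by fact
  have ab: "abelian_group L"
  proof (rule abelian_groupI)
    show "x \<oplus>\<^bsub>L\<^esub> y \<in> carrier L" if "x \<in> carrier L" "y \<in> carrier L" for x y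
      using that by (auto simp: im[symmetric] lmod_hom_add[OF c, symmetric])
    show "x \<oplus>\<^bsub>L\<^esub> y \<oplus>\<^bsub>L\<^esub> z = x \<oplus>\<^bsub>L\<^esub> (y \<oplus>\<^bsub>L\<^esub> z)"
      if "x \<in> carrier L" "y \<in> carrier L" "z \<in> carrier L" for x y z
      using that by (auto simp: im[symmetric] lmod_hom_add[OF c, symmetric] P.M.a_assoc)
    show "x \<oplus>\<^bsub>L\<^esub> y = y \<oplus>\<^bsub>L\<^esub> x" if "x \<in> carrier L" "y \<in> carrier L" for x y
      using that by (auto simp: im[symmetric] lmod_hom_add[OF c, symmetric] P.M.a_comm)
    show "\<zero>\<^bsub>L\<^esub> \<oplus>\<^bsub>L\<^esub> x = x" if "x \<in> carrier L" for x
      using that by (auto simp: im[symmetric] zero[symmetric] lmod_hom_add[OF c, symmetric])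
    show "\<exists>y\<in>carrier L. y \<oplus>\<^bsub>L\<^esub> x = \<zero>\<^bsub>L\<^esub>" if x: "x \<in> carrier L" for x
    proof -
      obtain u where u: "u \<in> carrier P" "x = c u" using x unfolding im[symmetric] by blast
      then have "c (\<ominus>\<^bsub>P\<^esub> u) \<oplus>\<^bsub>L\<^esub> x = \<zero>\<^bsub>L\<^esub>"
        by (simp add: zero[symmetric] lmod_hom_add[OF c, symmetric] P.M.l_neg)
      then show ?thesis using u lmod_hom_closed[OF c, of "\<ominus>\<^bsub>P\<^esub> u"] by blast
    qed
  next
    show "\<zero>\<^bsub>L\<^esub> \<in> carrier L"
      using lmod_hom_closed[OF c P.M.zero_closed] zero by simp
  qed
  show ?thesis
  proof (intro left_module.intro left_module_axioms.intro ab P.R.ring_axioms)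
    note simps = im[symmetric] lmod_hom_add[OF c, symmetric] lmod_hom_smult[OF c, symmetric] P.smult_closed
    show "a \<odot>\<^bsub>L\<^esub> x \<in> carrier L" if "a \<in> carrier R" "x \<in> carrier L" for a x
      using that by (auto simp: simps)
    show "(a \<oplus>\<^bsub>R\<^esub> b) \<odot>\<^bsub>L\<^esub> x = a \<odot>\<^bsub>L\<^esub> x \<oplus>\<^bsub>L\<^esub> b \<odot>\<^bsub>L\<^esub> x"
      if "a \<in> carrier R" "b \<in> carrier R" "x \<in> carrier L" for a b x
      using that by (auto simp: simps P.smult_l_distr)
    show "a \<odot>\<^bsub>L\<^esub> (x \<oplus>\<^bsub>L\<^esub> y) = a \<odot>\<^bsub>L\<^esub> x \<oplus>\<^bsub>L\<^esub> a \<odot>\<^bsub>L\<^esub> y"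
      if "a \<in> carrier R" "x \<in> carrier L" "y \<in> carrier L" for a x y
      using that by (auto simp: simps P.smult_r_distr)
    show "(a \<otimes>\<^bsub>R\<^esub> b) \<odot>\<^bsub>L\<^esub> x = a \<odot>\<^bsub>L\<^esub> (b \<odot>\<^bsub>L\<^esub> x)"
      if "a \<in> carrier R" "b \<in> carrier R" "x \<in> carrier L" for a b x
      using that by (auto simp: simps P.smult_assoc)
    show "\<one>\<^bsub>R\<^esub> \<odot>\<^bsub>L\<^esub> x = x" if "x \<in> carrier L" for x
      using that by (auto simp: simps P.smult_one)
  qed
qed

text \<open>A copy of the regular module in a function type, the form in which it can serve as a
  test module for projectivity.\<close>

lemma (in ring) left_module_constant_functions:
  defines "N \<equiv> \<lparr>carrier = (\<lambda>a _. a) ` carrier R, monoid.mult = undefined, one = undefined,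
      zero = (\<lambda>_. \<zero>), add = (\<lambda>u v i. u i \<oplus> v i), smult = (\<lambda>a u i. a \<otimes> u i)\<rparr>"
  shows "left_module R N"
proof (intro left_module.intro left_module_axioms.intro ring_axioms)
  show "abelian_group N"
  proof (rule abelian_groupI)
    fix x assume "x \<in> carrier N"
    then obtain a where a: "a \<in> carrier R" "x = (\<lambda>_. a)" by (auto simp: N_def)
    show "\<exists>y\<in>carrier N. y \<oplus>\<^bsub>N\<^esub> x = \<zero>\<^bsub>N\<^esub>"
      using a by (intro bexI[of _ "\<lambda>_. \<ominus> a"]) (auto simp: N_def l_neg)
  qed (auto simp: N_def a_ac)
qed (auto simp: N_def l_distr r_distr m_assoc)

text \<open>
  The test modules for projectivity are a set of representatives in \<open>P\<close> of the cyclic quotient,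
  and \<open>R\<close> itself as a module of constant functions.
\<close>

lemma projective_lift_cyclic:
  fixes P :: "('r, 'p) module"
  assumes proj: "projective_lmod R P" and N: "left_module R N" and eps: "eps \<in> lmod_hom R P N"
    and p: "p \<in> carrier P"
    and cyc: "\<And>x. x \<in> carrier P \<Longrightarrow> \<exists>a\<in>carrier R. eps x = a \<odot>\<^bsub>N\<^esub> eps p"
  obtains \<beta> where "\<And>x. x \<in> carrier P \<Longrightarrow> \<beta> x \<in> carrier R"
    and "\<And>x y. \<lbrakk>x \<in> carrier P; y \<in> carrier P\<rbrakk> \<Longrightarrow> \<beta> (x \<oplus>\<^bsub>P\<^esub> y) = \<beta> x \<oplus>\<^bsub>R\<^esub> \<beta> y"
    and "\<And>a x. \<lbrakk>a \<in> carrier R; x \<in> carrier P\<rbrakk> \<Longrightarrow> \<beta> (a \<odot>\<^bsub>P\<^esub> x) = a \<otimes>\<^bsub>R\<^esub> \<beta> x"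
    and "\<And>x. x \<in> carrier P \<Longrightarrow> \<beta> x \<odot>\<^bsub>N\<^esub> eps p = eps x"
proof -
  interpret P: left_module R P using proj by (simp add: projective_lmod_def)
  interpret N: left_module R N by fact
  \<comment> \<open>One representative for each fibre of \<open>eps\<close>: the value
    \<open>c x\<close> depends on \<open>eps x\<close> alone, so the image of \<open>c\<close> is a
    copy inside \<open>'p\<close> of the image of \<open>eps\<close>.\<close>
  define c where "c x = (SOME y. y \<in> carrier P \<and> eps y = eps x)" for x
  have c: "c x \<in> carrier P" "eps (c x) = eps x" if "x \<in> carrier P" for x
    using someI[of "\<lambda>y. y \<in> carrier P \<and> eps y = eps x" x] that by (auto simp: c_def)
  have c_cong: "c x = c y" if "eps x = eps y" for x y
    using that by (simp add: c_def)
  define L :: "('r, 'p) module" where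
    "L = \<lparr>carrier = c ` carrier P, monoid.mult = undefined, one = undefined, zero = c \<zero>\<^bsub>P\<^esub>,
      add = (\<lambda>x y. c (x \<oplus>\<^bsub>P\<^esub> y)), smult = (\<lambda>a x. c (a \<odot>\<^bsub>P\<^esub> x))\<rparr>"
  have hom_c: "c \<in> lmod_hom R P L"
    by (rule lmod_homI)
      (auto simp: L_def c P.smult_closed lmod_hom_add[OF eps] lmod_hom_smult[OF eps] intro!: c_cong)
  have L: "left_module R L"
    using P.left_module_axioms hom_c by (rule left_module_image) (simp_all add: L_def)
  define N' :: "('r, 'p \<Rightarrow> 'r) module" where
    "N' = \<lparr>carrier = (\<lambda>a _. a) ` carrier R, monoid.mult = undefined, one = undefined,
      zero = (\<lambda>_. \<zero>\<^bsub>R\<^esub>), add = (\<lambda>u v i. u i \<oplus>\<^bsub>R\<^esub> v i), smult = (\<lambda>a u i. a \<otimes>\<^bsub>R\<^esub> u i)\<rparr>"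
  have N': "left_module R N'"
    unfolding N'_def by (rule P.R.left_module_constant_functions)
  \<comment> \<open>The elements of \<open>N'\<close> are constant functions, so evaluation at
    \<open>undefined\<close> recovers the ring element. Up to this coding \<open>f\<close> is
    \<open>a \<mapsto> a \<cdot> p\<close> modulo the kernel of \<open>eps\<close>, which is onto by
    \<open>cyc\<close>; lifting \<open>c\<close> through it gives \<open>\<beta>\<close>.\<close>
  define f where "f u = c (u undefined \<odot>\<^bsub>P\<^esub> p)" for u :: "'p \<Rightarrow> 'r"
  have hom_f: "f \<in> lmod_hom R N' L"
    by (rule lmod_homI)
      (auto simp: N'_def f_def L_def c p P.smult_closed P.smult_l_distr P.smult_assoc
        lmod_hom_add[OF eps] lmod_hom_smult[OF eps] intro!: c_cong)
  have im_f: "f ` carrier N' = carrier L"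
  proof
    show "f ` carrier N' \<subseteq> carrier L" using lmod_hom_closed[OF hom_f] by blast
    show "carrier L \<subseteq> f ` carrier N'"
    proof
      fix y assume "y \<in> carrier L"
      then obtain x where x: "x \<in> carrier P" "y = c x" by (auto simp: L_def)
      obtain a where a: "a \<in> carrier R" "eps x = a \<odot>\<^bsub>N\<^esub> eps p" using cyc[OF x(1)] by blast
      have "y = f (\<lambda>_. a)"
        using x a p by (auto simp: f_def lmod_hom_smult[OF eps] intro: c_cong)
      then show "y \<in> f ` carrier N'" using a by (auto simp: N'_def)
    qed
  qed
  have "\<exists>h\<in>lmod_hom R P N'. \<forall>x\<in>carrier P. f (h x) = c x"
    using proj[unfolded projective_lmod_def, THEN conjunct2, rule_format, OF conjI, OF N' conjI,
        OF L conjI, OF hom_f conjI, OF im_f hom_c] .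
  then obtain h where h: "h \<in> lmod_hom R P N'" and fh: "\<And>x. x \<in> carrier P \<Longrightarrow> f (h x) = c x"
    by blast
  have h_const: "\<exists>a\<in>carrier R. h x = (\<lambda>_. a)" if "x \<in> carrier P" for x
    using lmod_hom_closed[OF h that] by (auto simp: N'_def)
  show thesis
  proof (rule that[of "\<lambda>x. h x undefined"])
    fix x assume x: "x \<in> carrier P"
    from h_const[OF x] show hx: "h x undefined \<in> carrier R" by auto
    have "eps (f (h x)) = h x undefined \<odot>\<^bsub>N\<^esub> eps p"
      using hx p by (simp add: f_def c P.smult_closed lmod_hom_smult[OF eps])
    then show "h x undefined \<odot>\<^bsub>N\<^esub> eps p = eps x"
      using fh[OF x] c[OF x] by simp
    show "h (x \<oplus>\<^bsub>P\<^esub> y) undefined = h x undefined \<oplus>\<^bsub>R\<^esub> h y undefined" if "y \<in> carrier P" for y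
      using lmod_hom_add[OF h x that] by (simp add: N'_def)
    show "h (a \<odot>\<^bsub>P\<^esub> x) undefined = a \<otimes>\<^bsub>R\<^esub> h x undefined" if "a \<in> carrier R" for a
      using lmod_hom_smult[OF h that x] by (simp add: N'_def)
  qed
qed

section \<open>Groups of maps and isomorphisms between their quotients\<close>

lemma (in abelian_group) pointwise_comm_group:
  assumes F: "F \<subseteq> X \<rightarrow>\<^sub>E carrier G" and zero: "(\<lambda>x\<in>X. \<zero>) \<in> F"
    and add: "\<And>f g. \<lbrakk>f \<in> F; g \<in> F\<rbrakk> \<Longrightarrow> (\<lambda>x\<in>X. f x \<oplus> g x) \<in> F"
    and neg: "\<And>f. f \<in> F \<Longrightarrow> (\<lambda>x\<in>X. \<ominus> f x) \<in> F"
  shows "comm_group (pointwise_group X G F)"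
proof -
  have mem: "f x \<in> carrier G" if "f \<in> F" "x \<in> X" for f x
    using F that by (auto simp: PiE_def)
  have ext: "f = g" if "f \<in> F" "g \<in> F" "\<And>x. x \<in> X \<Longrightarrow> f x = g x" for f g
    using that F by (intro extensionalityI[of f X g]) (auto simp: PiE_def)
  show ?thesis
  proof (rule comm_groupI)
    fix f assume "f \<in> carrier (pointwise_group X G F)"
    then have f: "f \<in> F" by (simp add: pointwise_group_def)
    show "\<exists>g\<in>carrier (pointwise_group X G F). g \<otimes>\<^bsub>pointwise_group X G F\<^esub> f = \<one>\<^bsub>pointwise_group X G F\<^esub>"
      using f neg mem by (intro bexI[of _ "\<lambda>x\<in>X. \<ominus> f x"])
        (auto simp: pointwise_group_def l_neg intro!: restrict_ext)
    show "\<one>\<^bsub>pointwise_group X G F\<^esub> \<otimes>\<^bsub>pointwise_group X G F\<^esub> f = f"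
      using ext[OF add[OF zero f] f] mem[OF f] by (simp add: pointwise_group_def)
  qed (auto simp: pointwise_group_def zero add mem a_ac intro!: restrict_ext)
qed

text \<open>The first isomorphism theorem for \<open>h\<close> followed by the projection to
  \<open>D Mod B\<close>. Hence \<open>surj\<close> asks for surjectivity modulo \<open>B\<close>
  only, and \<open>ker\<close> makes \<open>A\<close> the kernel of the composite, from which its
  normality follows.\<close>

lemma FactGroup_isoI:
  assumes Z: "group Z" and D: "comm_group D" and B: "subgroup B D" and h: "h \<in> hom Z D"
    and surj: "\<And>x. x \<in> carrier D \<Longrightarrow> \<exists>z\<in>carrier Z. \<exists>b\<in>B. x = b \<otimes>\<^bsub>D\<^esub> h z"
    and ker: "\<And>z. z \<in> carrier Z \<Longrightarrow> h z \<in> B \<longleftrightarrow> z \<in> A" and A: "A \<subseteq> carrier Z"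
  shows "Z Mod A \<cong> D Mod B"
proof -
  interpret D: comm_group D by fact
  interpret B: normal B D using B by (simp add: D.normal_iff_subgroup)
  define q where "q = (\<lambda>a. B #>\<^bsub>D\<^esub> a) \<circ> h"
  have hc: "h z \<in> carrier D" if "z \<in> carrier Z" for z
    using h that by (rule hom_in_carrier)
  have q: "q \<in> hom Z (D Mod B)"
    unfolding q_def using h B.r_coset_hom_Mod by (rule hom_compose)
  interpret q: group_hom Z "D Mod B" q
    using Z B.factorgroup_is_group q by (simp add: group_hom_def group_hom_axioms_def)
  have "q ` carrier Z = carrier (D Mod B)"
  proof
    show "q ` carrier Z \<subseteq> carrier (D Mod B)" by auto
    show "carrier (D Mod B) \<subseteq> q ` carrier Z"
    proof
      fix C assume "C \<in> carrier (D Mod B)"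
      then obtain x where x: "x \<in> carrier D" "C = B #>\<^bsub>D\<^esub> x"
        by (auto simp: FactGroup_def RCOSETS_def)
      obtain z b where z: "z \<in> carrier Z" "b \<in> B" "x = b \<otimes>\<^bsub>D\<^esub> h z" using surj[OF x(1)] by blast
      have "C = B #>\<^bsub>D\<^esub> b #>\<^bsub>D\<^esub> h z"
        using z hc x B.subset by (simp add: D.coset_mult_assoc B.mem_carrier)
      also have "\<dots> = q z"
        using z B by (simp add: q_def D.coset_join2 B.mem_carrier)
      finally show "C \<in> q ` carrier Z" using z by blast
    qed
  qed
  moreover have "kernel Z (D Mod B) q = A"
  proof -
    have "q z = \<one>\<^bsub>D Mod B\<^esub> \<longleftrightarrow> z \<in> A" if "z \<in> carrier Z" for z
      using ker[OF that] hc[OF that] B D.coset_join1[OF _ _ B] D.coset_join2[OF _ B] B.subset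
      by (auto simp: q_def FactGroup_def)
    then show ?thesis using A by (auto simp: kernel_def)
  qed
  ultimately show ?thesis using q.FactGroup_iso by simp
qed

section \<open>First Ext group of a cyclic module\<close>

text \<open>Degrees 0 to 2 of a resolution determine the first Ext group. The maps
  \<open>a \<mapsto> a \<cdot> p\<close> and \<open>\<beta>\<close> compare \<open>R\<close> with
  \<open>P0\<close> in the two directions. \<open>\<beta>\<close> is described by equations instead
  of \<open>lmod_hom\<close>, since its target is a ring and not a module record.\<close>

locale cyclic_presentation =
  R: ring R + M: left_module R M + N: left_module R N +
  P0: left_module R P0 + P1: left_module R P1 + P2: left_module R P2
  for R :: "('r, 'x) ring_scheme" and M :: "('r, 'm) module" and N :: "('r, 'n) module"
    and P0 :: "('r, 'p) module" and P1 :: "('r, 'p) module" and P2 :: "('r, 'p) module" +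
  fixes d0 d1 :: "'p \<Rightarrow> 'p" and eps :: "'p \<Rightarrow> 'n" and p :: 'p and \<beta> :: "'p \<Rightarrow> 'r"
  assumes d0: "d0 \<in> lmod_hom R P1 P0" and d1: "d1 \<in> lmod_hom R P2 P1"
    and eps: "eps \<in> lmod_hom R P0 N"
    and exact0: "d0 ` carrier P1 = {x \<in> carrier P0. eps x = \<zero>\<^bsub>N\<^esub>}"
    and exact1: "d1 ` carrier P2 = {x \<in> carrier P1. d0 x = \<zero>\<^bsub>P0\<^esub>}"
    and p: "p \<in> carrier P0"
    and \<beta>_closed: "\<And>x. x \<in> carrier P0 \<Longrightarrow> \<beta> x \<in> carrier R"
    and \<beta>_add: "\<And>x y. \<lbrakk>x \<in> carrier P0; y \<in> carrier P0\<rbrakk> \<Longrightarrow> \<beta> (x \<oplus>\<^bsub>P0\<^esub> y) = \<beta> x \<oplus>\<^bsub>R\<^esub> \<beta> y"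
    and \<beta>_smult: "\<And>a x. \<lbrakk>a \<in> carrier R; x \<in> carrier P0\<rbrakk> \<Longrightarrow> \<beta> (a \<odot>\<^bsub>P0\<^esub> x) = a \<otimes>\<^bsub>R\<^esub> \<beta> x"
    and \<beta>_eps: "\<And>x. x \<in> carrier P0 \<Longrightarrow> \<beta> x \<odot>\<^bsub>N\<^esub> eps p = eps x"
begin

definition Ann :: "'r set" where "Ann = {a \<in> carrier R. a \<odot>\<^bsub>N\<^esub> eps p = \<zero>\<^bsub>N\<^esub>}"

text \<open>Linearity is spelled out because \<open>Ann\<close> is a left ideal, a set of ring
  elements without a module record of its own.\<close>

definition hom_Ann :: "('r \<Rightarrow> 'm) set" where
  "hom_Ann = {\<phi> \<in> Ann \<rightarrow>\<^sub>E carrier M.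
    (\<forall>a\<in>Ann. \<forall>b\<in>Ann. \<phi> (a \<oplus>\<^bsub>R\<^esub> b) = \<phi> a \<oplus>\<^bsub>M\<^esub> \<phi> b) \<and>
    (\<forall>a\<in>carrier R. \<forall>b\<in>Ann. \<phi> (a \<otimes>\<^bsub>R\<^esub> b) = a \<odot>\<^bsub>M\<^esub> \<phi> b)}"

text \<open>The image of the restriction \<open>Hom(R, M) \<rightarrow> Hom(Ann, M)\<close>: every
  homomorphism from \<open>R\<close> to \<open>M\<close> has the form
  \<open>a \<mapsto> a \<cdot> m\<close>.\<close>

definition inner_Ann :: "('r \<Rightarrow> 'm) set" where
  "inner_Ann = (\<lambda>m. \<lambda>a\<in>Ann. a \<odot>\<^bsub>M\<^esub> m) ` carrier M"

text \<open>This set and \<open>coboundaries\<close> are \<open>ext_cocycles\<close> and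
  \<open>ext_coboundaries\<close> in degree 1, stated without an indexed resolution.\<close>

definition cocycles :: "('p \<Rightarrow> 'm) set" where
  "cocycles = {f \<in> lmod_hom R P1 M \<inter> extensional (carrier P1). \<forall>w\<in>carrier P2. f (d1 w) = \<zero>\<^bsub>M\<^esub>}"

definition coboundaries :: "('p \<Rightarrow> 'm) set" where
  "coboundaries = (\<lambda>F. \<lambda>x\<in>carrier P1. F (d0 x)) ` (lmod_hom R P0 M \<inter> extensional (carrier P0))"

lemma eps_p: "eps p \<in> carrier N"
  using lmod_hom_closed[OF eps p] .

lemma Ann_closed: "a \<in> Ann \<Longrightarrow> a \<in> carrier R" by (simp add: Ann_def)

lemma Ann_add: "\<lbrakk>a \<in> Ann; b \<in> Ann\<rbrakk> \<Longrightarrow> a \<oplus>\<^bsub>R\<^esub> b \<in> Ann"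
  by (simp add: Ann_def N.smult_l_distr eps_p)

lemma Ann_mult: "\<lbrakk>a \<in> carrier R; b \<in> Ann\<rbrakk> \<Longrightarrow> a \<otimes>\<^bsub>R\<^esub> b \<in> Ann"
  by (simp add: Ann_def N.smult_assoc eps_p)

lemma Ann_zero: "\<zero>\<^bsub>R\<^esub> \<in> Ann"
  by (simp add: Ann_def eps_p)

lemma \<beta>_zero: "\<beta> \<zero>\<^bsub>P0\<^esub> = \<zero>\<^bsub>R\<^esub>"
  using \<beta>_smult[OF R.zero_closed P0.M.zero_closed] \<beta>_closed[of "\<zero>\<^bsub>P0\<^esub>"] by simp

lemma \<beta>_Ann: assumes "x \<in> carrier P1" shows "\<beta> (d0 x) \<in> Ann"
proof -
  have "d0 x \<in> carrier P0" "eps (d0 x) = \<zero>\<^bsub>N\<^esub>" using exact0 assms by blast+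
  then show ?thesis by (simp add: Ann_def \<beta>_closed \<beta>_eps)
qed

lemma d0_d1: "w \<in> carrier P2 \<Longrightarrow> d0 (d1 w) = \<zero>\<^bsub>P0\<^esub>"
  using exact1 by blast

lemma smult_p_closed: "a \<in> carrier R \<Longrightarrow> a \<odot>\<^bsub>P0\<^esub> p \<in> carrier P0"
  using p by (simp add: P0.smult_closed)

text \<open>An arbitrary choice of preimages, in general not additive. Only cocycles are evaluated
  on it, and by \<open>cocycle_cong\<close> their values do not depend on the choice.\<close>

definition lift :: "'p \<Rightarrow> 'p" where "lift x = (SOME y. y \<in> carrier P1 \<and> d0 y = x)"

lemma lift:
  assumes "x \<in> carrier P0" "eps x = \<zero>\<^bsub>N\<^esub>"
  shows "lift x \<in> carrier P1" "d0 (lift x) = x"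
proof -
  have "x \<in> d0 ` carrier P1" using assms exact0 by blast
  then have "\<exists>y. y \<in> carrier P1 \<and> d0 y = x" by blast
  then have "lift x \<in> carrier P1 \<and> d0 (lift x) = x" unfolding lift_def by (rule someI_ex)
  then show "lift x \<in> carrier P1" "d0 (lift x) = x" by simp_all
qed

lemma lift_Ann:
  assumes "a \<in> Ann"
  shows "lift (a \<odot>\<^bsub>P0\<^esub> p) \<in> carrier P1" "d0 (lift (a \<odot>\<^bsub>P0\<^esub> p)) = a \<odot>\<^bsub>P0\<^esub> p"
proof -
  have "a \<in> carrier R" "eps (a \<odot>\<^bsub>P0\<^esub> p) = \<zero>\<^bsub>N\<^esub>"
    using assms p lmod_hom_smult[OF eps] by (auto simp: Ann_def)
  then show "lift (a \<odot>\<^bsub>P0\<^esub> p) \<in> carrier P1" "d0 (lift (a \<odot>\<^bsub>P0\<^esub> p)) = a \<odot>\<^bsub>P0\<^esub> p"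
    using lift smult_p_closed by simp_all
qed

text \<open>By exactness \<open>x - y\<close> lies in the image of \<open>d1\<close>, where
  \<open>f\<close> vanishes. A cocycle is thus a function on the image of \<open>d0\<close>, that
  is, on the kernel of \<open>eps\<close>.\<close>

lemma cocycle_cong:
  assumes f: "f \<in> cocycles" and x: "x \<in> carrier P1" and y: "y \<in> carrier P1" and eq: "d0 x = d0 y"
  shows "f x = f y"
proof -
  have fh: "f \<in> lmod_hom R P1 M" using f by (simp add: cocycles_def)
  have "d0 (x \<ominus>\<^bsub>P1\<^esub> y) = d0 y \<ominus>\<^bsub>P0\<^esub> d0 y"
    using x y lmod_hom_diff[OF P1.left_module_axioms P0.left_module_axioms d0] by (simp add: eq)
  also have "\<dots> = \<zero>\<^bsub>P0\<^esub>"
    using y lmod_hom_closed[OF d0] by (simp add: a_minus_def P0.M.r_neg)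
  finally have "x \<ominus>\<^bsub>P1\<^esub> y \<in> d1 ` carrier P2"
    using x y exact1 by simp
  then have "f (x \<ominus>\<^bsub>P1\<^esub> y) = \<zero>\<^bsub>M\<^esub>"
    using f by (auto simp: cocycles_def)
  then have "f x \<ominus>\<^bsub>M\<^esub> f y = \<zero>\<^bsub>M\<^esub>"
    using x y lmod_hom_diff[OF P1.left_module_axioms M.left_module_axioms fh] by simp
  then have "f x \<ominus>\<^bsub>M\<^esub> f y \<oplus>\<^bsub>M\<^esub> f y = f y"
    using y lmod_hom_closed[OF fh] by simp
  then show ?thesis
    using x y lmod_hom_closed[OF fh] by (simp add: a_minus_def M.M.a_assoc M.M.l_neg)
qed

lemma cocycles_hom: "f \<in> cocycles \<Longrightarrow> f \<in> lmod_hom R P1 M"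
  by (simp add: cocycles_def)

section \<open>The groups of cocycles and of homomorphisms on \<open>Ann\<close>\<close>

lemma cocycles_pointwise: "comm_group (pointwise_group (carrier P1) M cocycles)"
proof (rule M.M.pointwise_comm_group)
  show "cocycles \<subseteq> carrier P1 \<rightarrow>\<^sub>E carrier M"
    by (auto simp: cocycles_def lmod_hom_def PiE_def)
  have d1c: "d1 w \<in> carrier P1" if "w \<in> carrier P2" for w
    using lmod_hom_closed[OF d1 that] .
  show "(\<lambda>x\<in>carrier P1. \<zero>\<^bsub>M\<^esub>) \<in> cocycles"
    by (auto simp: cocycles_def P1.smult_closed d1c intro!: lmod_homI)
  show "(\<lambda>x\<in>carrier P1. f x \<oplus>\<^bsub>M\<^esub> g x) \<in> cocycles" if f: "f \<in> cocycles" and g: "g \<in> cocycles" for f g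
    using f[unfolded cocycles_def] g[unfolded cocycles_def] lmod_hom_closed[OF cocycles_hom[OF f]] lmod_hom_closed[OF cocycles_hom[OF g]]
    by (auto simp: cocycles_def P1.smult_closed d1c lmod_hom_add[OF cocycles_hom[OF f]] lmod_hom_add[OF cocycles_hom[OF g]]
        lmod_hom_smult[OF cocycles_hom[OF f]] lmod_hom_smult[OF cocycles_hom[OF g]] M.smult_r_distr M.M.a_ac
        intro!: lmod_homI)
  show "(\<lambda>x\<in>carrier P1. \<ominus>\<^bsub>M\<^esub> f x) \<in> cocycles" if f: "f \<in> cocycles" for f
    using f[unfolded cocycles_def] lmod_hom_closed[OF cocycles_hom[OF f]]
    by (auto simp: cocycles_def P1.smult_closed d1c lmod_hom_add[OF cocycles_hom[OF f]]
        lmod_hom_smult[OF cocycles_hom[OF f]] M.smult_r_minus M.M.minus_add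
        intro!: lmod_homI)
qed

lemma hom_AnnD:
  assumes "\<phi> \<in> hom_Ann"
  shows "a \<in> Ann \<Longrightarrow> \<phi> a \<in> carrier M"
    and "\<lbrakk>a \<in> Ann; b \<in> Ann\<rbrakk> \<Longrightarrow> \<phi> (a \<oplus>\<^bsub>R\<^esub> b) = \<phi> a \<oplus>\<^bsub>M\<^esub> \<phi> b"
    and "\<lbrakk>c \<in> carrier R; b \<in> Ann\<rbrakk> \<Longrightarrow> \<phi> (c \<otimes>\<^bsub>R\<^esub> b) = c \<odot>\<^bsub>M\<^esub> \<phi> b"
  using assms by (auto simp: hom_Ann_def)

lemma hom_Ann_pointwise: "comm_group (pointwise_group Ann M hom_Ann)"
proof (rule M.M.pointwise_comm_group)
  show "hom_Ann \<subseteq> Ann \<rightarrow>\<^sub>E carrier M"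
    by (auto simp: hom_Ann_def)
  show "(\<lambda>x\<in>Ann. \<zero>\<^bsub>M\<^esub>) \<in> hom_Ann"
    by (auto simp: hom_Ann_def Ann_add Ann_mult)
  show "(\<lambda>x\<in>Ann. f x \<oplus>\<^bsub>M\<^esub> g x) \<in> hom_Ann" if "f \<in> hom_Ann" "g \<in> hom_Ann" for f g
    using hom_AnnD[OF that(1)] hom_AnnD[OF that(2)]
    by (auto simp: hom_Ann_def Ann_add Ann_mult M.smult_r_distr M.M.a_ac)
  show "(\<lambda>x\<in>Ann. \<ominus>\<^bsub>M\<^esub> f x) \<in> hom_Ann" if "f \<in> hom_Ann" for f
    using hom_AnnD[OF that]
    by (auto simp: hom_Ann_def Ann_add Ann_mult M.smult_r_minus M.M.minus_add)
qed

lemma inner_Ann_subgroup: "subgroup inner_Ann (pointwise_group Ann M hom_Ann)"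
proof -
  interpret H: comm_group "pointwise_group Ann M hom_Ann" by (rule hom_Ann_pointwise)
  have sub: "inner_Ann \<subseteq> hom_Ann"
    by (auto simp: inner_Ann_def hom_Ann_def Ann_add Ann_mult Ann_closed M.smult_closed
        M.smult_l_distr M.smult_assoc)
  have "comm_group (pointwise_group Ann M inner_Ann)"
  proof (rule M.M.pointwise_comm_group)
    show "inner_Ann \<subseteq> Ann \<rightarrow>\<^sub>E carrier M" using sub by (auto simp: hom_Ann_def)
    show "(\<lambda>x\<in>Ann. \<zero>\<^bsub>M\<^esub>) \<in> inner_Ann"
      unfolding inner_Ann_def by (rule image_eqI[of _ _ "\<zero>\<^bsub>M\<^esub>"]) (auto simp: Ann_closed)
    show "(\<lambda>x\<in>Ann. f x \<oplus>\<^bsub>M\<^esub> g x) \<in> inner_Ann" if fg: "f \<in> inner_Ann" "g \<in> inner_Ann" for f g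
    proof -
      obtain m n where "m \<in> carrier M" "f = (\<lambda>a\<in>Ann. a \<odot>\<^bsub>M\<^esub> m)" "n \<in> carrier M" "g = (\<lambda>a\<in>Ann. a \<odot>\<^bsub>M\<^esub> n)"
        using fg by (auto simp: inner_Ann_def)
      then show ?thesis unfolding inner_Ann_def
        by (intro image_eqI[of _ _ "m \<oplus>\<^bsub>M\<^esub> n"]) (auto simp: Ann_closed M.smult_r_distr)
    qed
    show "(\<lambda>x\<in>Ann. \<ominus>\<^bsub>M\<^esub> f x) \<in> inner_Ann" if f: "f \<in> inner_Ann" for f
    proof -
      obtain m where "m \<in> carrier M" "f = (\<lambda>a\<in>Ann. a \<odot>\<^bsub>M\<^esub> m)"
        using f by (auto simp: inner_Ann_def)
      then show ?thesis unfolding inner_Ann_def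
        by (intro image_eqI[of _ _ "\<ominus>\<^bsub>M\<^esub> m"]) (auto simp: Ann_closed M.smult_r_minus)
    qed
  qed
  \<comment> \<open>The operations of \<open>pointwise_group\<close> do not depend on its carrier,
    so a group on the smaller set is a subgroup of the larger one.\<close>
  then have "group (pointwise_group Ann M hom_Ann\<lparr>carrier := inner_Ann\<rparr>)"
    by (simp add: pointwise_group_def comm_group.axioms(2))
  then show ?thesis
    using sub by (intro H.group_incl_imp_subgroup) (auto simp: pointwise_group_def)
qed

section \<open>The comparison map from cocycles to homomorphisms on \<open>Ann\<close>\<close>

definition ann_map :: "('p \<Rightarrow> 'm) \<Rightarrow> 'r \<Rightarrow> 'm" where
  "ann_map f = (\<lambda>a\<in>Ann. f (lift (a \<odot>\<^bsub>P0\<^esub> p)))"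

text \<open>\<open>ann_map\<close> pulls \<open>f\<close> back along
  \<open>a \<mapsto> a \<cdot> p\<close>, which sends \<open>Ann\<close> into the kernel of
  \<open>eps\<close>. The lift of a sum and the sum of the lifts may differ, but they have the same
  image under \<open>d0\<close>, so \<open>f\<close> takes the same value on both; likewise for
  multiples.\<close>

lemma ann_map_closed: assumes f: "f \<in> cocycles" shows "ann_map f \<in> hom_Ann"
proof -
  note fh = cocycles_hom[OF f]
  have "f (lift ((a \<oplus>\<^bsub>R\<^esub> b) \<odot>\<^bsub>P0\<^esub> p)) = f (lift (a \<odot>\<^bsub>P0\<^esub> p)) \<oplus>\<^bsub>M\<^esub> f (lift (b \<odot>\<^bsub>P0\<^esub> p))"
    if "a \<in> Ann" "b \<in> Ann" for a b
    unfolding lmod_hom_add[OF fh lift_Ann(1)[OF that(1)] lift_Ann(1)[OF that(2)], symmetric]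
    using that lift_Ann[OF Ann_add[OF that]] by (intro cocycle_cong[OF f])
      (simp_all add: lift_Ann Ann_closed lmod_hom_add[OF d0] P0.smult_l_distr p)
  moreover have "f (lift ((a \<otimes>\<^bsub>R\<^esub> b) \<odot>\<^bsub>P0\<^esub> p)) = a \<odot>\<^bsub>M\<^esub> f (lift (b \<odot>\<^bsub>P0\<^esub> p))"
    if "a \<in> carrier R" "b \<in> Ann" for a b
    unfolding lmod_hom_smult[OF fh that(1) lift_Ann(1)[OF that(2)], symmetric]
    using that lift_Ann[OF Ann_mult[OF that]] by (intro cocycle_cong[OF f])
      (simp_all add: lift_Ann Ann_closed lmod_hom_smult[OF d0] P0.smult_assoc P1.smult_closed p)
  ultimately show ?thesis
    by (auto simp: ann_map_def hom_Ann_def Ann_add Ann_mult lift_Ann intro: lmod_hom_closed[OF fh])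
qed

lemma ann_map_hom: "ann_map \<in> hom (pointwise_group (carrier P1) M cocycles) (pointwise_group Ann M hom_Ann)"
proof (rule homI)
  show "ann_map f \<in> carrier (pointwise_group Ann M hom_Ann)" if "f \<in> carrier (pointwise_group (carrier P1) M cocycles)" for f
    using that by (simp add: pointwise_group_def ann_map_closed)
qed (auto simp: pointwise_group_def ann_map_def lift_Ann intro!: restrict_ext)

text \<open>Pulling \<open>\<phi>\<close> back along \<open>\<beta>\<close> and then along
  \<open>a \<mapsto> a \<cdot> p\<close> amounts to right multiplication by
  \<open>\<beta> p\<close>. This element is \<open>1 + i\<close> with \<open>i\<close> in
  \<open>Ann\<close>, and \<open>\<phi> (a + a i) = \<phi> a + a \<cdot> \<phi> i\<close>; the inner
  map of \<open>- \<phi> i\<close> removes the second term.\<close>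

lemma ann_map_surj:
  assumes \<phi>: "\<phi> \<in> hom_Ann"
  shows "\<exists>f\<in>cocycles. \<exists>b\<in>inner_Ann. \<phi> = b \<otimes>\<^bsub>pointwise_group Ann M hom_Ann\<^esub> ann_map f"
proof -
  note \<phi>D = hom_AnnD[OF \<phi>]
  define f where "f = (\<lambda>z\<in>carrier P1. \<phi> (\<beta> (d0 z)))"
  \<comment> \<open>\<open>f\<close> is only a preimage of \<open>\<phi>\<close> up to the inner map of \<open>\<phi> i\<close>, as \<open>\<beta> p\<close> need not be \<open>1\<close>.\<close>
  define i where "i = \<beta> p \<ominus>\<^bsub>R\<^esub> \<one>\<^bsub>R\<^esub>"
  have d0c: "d0 z \<in> carrier P0" if "z \<in> carrier P1" for z
    using lmod_hom_closed[OF d0 that] .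
  have i: "i \<in> Ann"
    using p eps_p by (simp add: Ann_def i_def \<beta>_closed N.smult_l_diff \<beta>_eps N.smult_one)
      (simp add: a_minus_def N.M.r_neg)
  have \<phi>0: "\<phi> \<zero>\<^bsub>R\<^esub> = \<zero>\<^bsub>M\<^esub>"
    using \<phi>D(3)[OF R.zero_closed Ann_zero] \<phi>D(1)[OF Ann_zero] by simp
  have f: "f \<in> cocycles"
    using lmod_hom_closed[OF d1]
    by (auto simp: cocycles_def f_def \<phi>D \<beta>_Ann d0_d1 \<beta>_zero \<phi>0 P1.smult_closed d0c
        lmod_hom_add[OF d0] lmod_hom_smult[OF d0] \<beta>_add \<beta>_smult intro!: lmod_homI)
  have ann_mapf: "ann_map f a = \<phi> a \<oplus>\<^bsub>M\<^esub> a \<odot>\<^bsub>M\<^esub> \<phi> i" if a: "a \<in> Ann" for a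
  proof -
    have ac: "a \<in> carrier R" and ic: "i \<in> carrier R" using a i by (auto simp: Ann_closed)
    have "\<beta> p = \<one>\<^bsub>R\<^esub> \<oplus>\<^bsub>R\<^esub> i"
      using p R.a_lcomm[of "\<one>\<^bsub>R\<^esub>" "\<beta> p" "\<ominus>\<^bsub>R\<^esub> \<one>\<^bsub>R\<^esub>"]
      by (simp add: i_def a_minus_def \<beta>_closed R.r_neg)
    then have "a \<otimes>\<^bsub>R\<^esub> \<beta> p = a \<oplus>\<^bsub>R\<^esub> a \<otimes>\<^bsub>R\<^esub> i"
      using ac ic by (simp add: R.r_distr)
    then have "ann_map f a = \<phi> (a \<oplus>\<^bsub>R\<^esub> a \<otimes>\<^bsub>R\<^esub> i)"
      using a ac p by (simp add: ann_map_def f_def lift_Ann \<beta>_smult)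
    then show ?thesis using a ac i by (simp add: \<phi>D Ann_mult)
  qed
  define b where "b = (\<lambda>a\<in>Ann. a \<odot>\<^bsub>M\<^esub> (\<ominus>\<^bsub>M\<^esub> \<phi> i))"
  have "b \<in> inner_Ann" using \<phi>D(1)[OF i] by (auto simp: b_def inner_Ann_def)
  moreover have "\<phi> = b \<otimes>\<^bsub>pointwise_group Ann M hom_Ann\<^esub> ann_map f"
  proof (rule extensionalityI[of _ Ann])
    show "\<phi> \<in> extensional Ann" using \<phi> by (auto simp: hom_Ann_def PiE_def)
    show "b \<otimes>\<^bsub>pointwise_group Ann M hom_Ann\<^esub> ann_map f \<in> extensional Ann" by (simp add: pointwise_group_def)
    fix a assume a: "a \<in> Ann"
    have "\<ominus>\<^bsub>M\<^esub> (a \<odot>\<^bsub>M\<^esub> \<phi> i) \<oplus>\<^bsub>M\<^esub> (\<phi> a \<oplus>\<^bsub>M\<^esub> a \<odot>\<^bsub>M\<^esub> \<phi> i)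
        = \<phi> a \<oplus>\<^bsub>M\<^esub> (\<ominus>\<^bsub>M\<^esub> (a \<odot>\<^bsub>M\<^esub> \<phi> i) \<oplus>\<^bsub>M\<^esub> a \<odot>\<^bsub>M\<^esub> \<phi> i)"
      using a i \<phi>D(1) by (intro M.M.a_lcomm) (auto simp: Ann_closed M.smult_closed)
    also have "\<dots> = \<phi> a"
      using a i \<phi>D(1) by (simp add: Ann_closed M.smult_closed M.M.l_neg)
    finally have "\<ominus>\<^bsub>M\<^esub> (a \<odot>\<^bsub>M\<^esub> \<phi> i) \<oplus>\<^bsub>M\<^esub> (\<phi> a \<oplus>\<^bsub>M\<^esub> a \<odot>\<^bsub>M\<^esub> \<phi> i) = \<phi> a" .
    then show "\<phi> a = (b \<otimes>\<^bsub>pointwise_group Ann M hom_Ann\<^esub> ann_map f) a"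
      using a i \<phi>D(1) by (simp add: pointwise_group_def b_def ann_mapf M.smult_r_minus Ann_closed)
  qed
  ultimately show ?thesis using f by blast
qed

lemma coboundaries_subset: "coboundaries \<subseteq> cocycles"
proof
  fix f assume "f \<in> coboundaries"
  then obtain F where F: "F \<in> lmod_hom R P0 M" and f: "f = (\<lambda>x\<in>carrier P1. F (d0 x))"
    by (auto simp: coboundaries_def)
  have d0c: "d0 z \<in> carrier P0" if "z \<in> carrier P1" for z
    using lmod_hom_closed[OF d0 that] .
  show "f \<in> cocycles"
    using lmod_hom_closed[OF d1] lmod_hom_zero[OF P0.left_module_axioms M.left_module_axioms F]
    by (auto simp: cocycles_def f d0_d1 P1.smult_closed d0c lmod_hom_closed[OF F]
        lmod_hom_add[OF d0] lmod_hom_smult[OF d0] lmod_hom_add[OF F] lmod_hom_smult[OF F] intro!: lmod_homI)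
qed

text \<open>A coboundary coming from \<open>F\<close> is sent to
  \<open>a \<mapsto> a \<cdot> F p\<close>. For the other direction such an \<open>F\<close> is
  built with the value \<open>m\<close> prescribed along \<open>p\<close>.\<close>

lemma ann_map_ker:
  assumes f: "f \<in> cocycles" shows "ann_map f \<in> inner_Ann \<longleftrightarrow> f \<in> coboundaries"
proof
  note fh = cocycles_hom[OF f]
  assume "ann_map f \<in> inner_Ann"
  then obtain m where m: "m \<in> carrier M" and ann_mapf: "ann_map f = (\<lambda>a\<in>Ann. a \<odot>\<^bsub>M\<^esub> m)"
    by (auto simp: inner_Ann_def)
  have ann_mapf: "f (lift (a \<odot>\<^bsub>P0\<^esub> p)) = a \<odot>\<^bsub>M\<^esub> m" if "a \<in> Ann" for a
    using fun_cong[OF ann_mapf, of a] that by (simp add: ann_map_def)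
  \<comment> \<open>The identity of \<open>P0\<close> minus the round trip through \<open>R\<close>.
    It lands in the kernel of \<open>eps\<close>, so \<open>lift\<close> of it plays the part of a
    chain homotopy, and \<open>x = v x + \<beta> x \<cdot> p\<close> splits the definition of
    \<open>F\<close> below.\<close>
  define v where "v x = x \<ominus>\<^bsub>P0\<^esub> \<beta> x \<odot>\<^bsub>P0\<^esub> p" for x
  have v: "v x \<in> carrier P0" "eps (v x) = \<zero>\<^bsub>N\<^esub>" if x: "x \<in> carrier P0" for x
  proof -
    show "v x \<in> carrier P0" using x by (simp add: v_def \<beta>_closed smult_p_closed)
    have "eps (v x) = eps x \<ominus>\<^bsub>N\<^esub> eps x"
      using x p by (simp add: v_def lmod_hom_diff[OF P0.left_module_axioms N.left_module_axioms eps]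
          \<beta>_closed smult_p_closed lmod_hom_smult[OF eps] \<beta>_eps)
    then show "eps (v x) = \<zero>\<^bsub>N\<^esub>"
      using lmod_hom_closed[OF eps x] by (simp add: a_minus_def N.M.r_neg)
  qed
  have v_add: "v (x \<oplus>\<^bsub>P0\<^esub> y) = v x \<oplus>\<^bsub>P0\<^esub> v y" if "x \<in> carrier P0" "y \<in> carrier P0" for x y
    using that p by (simp add: v_def \<beta>_add \<beta>_closed P0.smult_l_distr smult_p_closed a_minus_def
        P0.M.minus_add P0.M.a_ac)
  have v_smult: "v (a \<odot>\<^bsub>P0\<^esub> x) = a \<odot>\<^bsub>P0\<^esub> v x" if "a \<in> carrier R" "x \<in> carrier P0" for a x
    using that p by (simp add: v_def \<beta>_smult \<beta>_closed P0.smult_r_diff P0.smult_assoc smult_p_closed)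
  \<comment> \<open>\<open>\<beta>\<close> maps into \<open>Ann\<close> on boundaries, where \<open>f\<close> is already \<open>a \<cdot> m\<close>, so \<open>F\<close> extends \<open>f\<close> along \<open>d0\<close>.\<close>
  define F where "F = (\<lambda>x\<in>carrier P0. f (lift (v x)) \<oplus>\<^bsub>M\<^esub> \<beta> x \<odot>\<^bsub>M\<^esub> m)"
  have fl: "f (lift (v x)) \<in> carrier M" if "x \<in> carrier P0" for x
    using lmod_hom_closed[OF fh] lift v that by blast
  have fv_add: "f (lift (v (x \<oplus>\<^bsub>P0\<^esub> y))) = f (lift (v x)) \<oplus>\<^bsub>M\<^esub> f (lift (v y))"
    if "x \<in> carrier P0" "y \<in> carrier P0" for x y
  proof -
    have "f (lift (v (x \<oplus>\<^bsub>P0\<^esub> y))) = f (lift (v x) \<oplus>\<^bsub>P1\<^esub> lift (v y))"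
      using that v[of "x \<oplus>\<^bsub>P0\<^esub> y"] by (intro cocycle_cong[OF f]) (simp_all add: lift v lmod_hom_add[OF d0] v_add)
    then show ?thesis using that by (simp add: lift v lmod_hom_add[OF fh])
  qed
  have fv_smult: "f (lift (v (a \<odot>\<^bsub>P0\<^esub> x))) = a \<odot>\<^bsub>M\<^esub> f (lift (v x))"
    if "a \<in> carrier R" "x \<in> carrier P0" for a x
  proof -
    have "f (lift (v (a \<odot>\<^bsub>P0\<^esub> x))) = f (a \<odot>\<^bsub>P1\<^esub> lift (v x))"
      using that v[of "a \<odot>\<^bsub>P0\<^esub> x"]
      by (intro cocycle_cong[OF f]) (simp_all add: lift v lmod_hom_smult[OF d0] v_smult P0.smult_closed P1.smult_closed)
    then show ?thesis using that by (simp add: lift v lmod_hom_smult[OF fh])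
  qed
  have F: "F \<in> lmod_hom R P0 M"
  proof (rule lmod_homI)
    show "F x \<in> carrier M" if "x \<in> carrier P0" for x
      using that m by (simp add: F_def fl \<beta>_closed M.smult_closed)
    show "F (x \<oplus>\<^bsub>P0\<^esub> y) = F x \<oplus>\<^bsub>M\<^esub> F y" if "x \<in> carrier P0" "y \<in> carrier P0" for x y
      using that m by (simp add: F_def fv_add \<beta>_add fl \<beta>_closed M.smult_closed M.smult_l_distr M.M.a_ac)
    show "F (a \<odot>\<^bsub>P0\<^esub> x) = a \<odot>\<^bsub>M\<^esub> F x" if "a \<in> carrier R" "x \<in> carrier P0" for a x
      using that m by (simp add: F_def fv_smult \<beta>_smult fl \<beta>_closed M.smult_closed P0.smult_closed
          M.smult_r_distr M.smult_assoc)
  qed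
  have Fd0: "F (d0 z) = f z" if z: "z \<in> carrier P1" for z
  proof -
    let ?x = "d0 z" and ?b = "\<beta> (d0 z)"
    have x: "?x \<in> carrier P0" using lmod_hom_closed[OF d0 z] .
    have b: "?b \<in> Ann" using \<beta>_Ann[OF z] .
    then have bc: "?b \<in> carrier R" by (rule Ann_closed)
    \<comment> \<open>As \<open>?b\<close> is in \<open>Ann\<close>, the term
      \<open>?b \<cdot> m\<close> equals \<open>f (lift (?b \<cdot> p))\<close>. The sum of the two
      lifts then has the same image under \<open>d0\<close> as \<open>z\<close>.\<close>
    have "F ?x = f (lift (v ?x) \<oplus>\<^bsub>P1\<^esub> lift (?b \<odot>\<^bsub>P0\<^esub> p))"
      using x b by (simp add: F_def ann_mapf[symmetric] lmod_hom_add[OF fh] lift v lift_Ann)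
    also have "\<dots> = f z"
    proof (rule cocycle_cong[OF f _ z])
      show "lift (v ?x) \<oplus>\<^bsub>P1\<^esub> lift (?b \<odot>\<^bsub>P0\<^esub> p) \<in> carrier P1"
        using x b by (simp add: lift v lift_Ann)
      have "d0 (lift (v ?x) \<oplus>\<^bsub>P1\<^esub> lift (?b \<odot>\<^bsub>P0\<^esub> p)) = v ?x \<oplus>\<^bsub>P0\<^esub> ?b \<odot>\<^bsub>P0\<^esub> p"
        using x b by (simp add: lift v lift_Ann lmod_hom_add[OF d0])
      also have "\<dots> = ?x"
        using x bc by (simp add: v_def a_minus_def smult_p_closed P0.M.a_assoc P0.M.l_neg)
      finally show "d0 (lift (v ?x) \<oplus>\<^bsub>P1\<^esub> lift (?b \<odot>\<^bsub>P0\<^esub> p)) = ?x" .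
    qed
    finally show ?thesis .
  qed
  have "f = (\<lambda>x\<in>carrier P1. F (d0 x))"
    using f by (intro extensionalityI[of f "carrier P1"]) (auto simp: cocycles_def Fd0)
  moreover have "F \<in> extensional (carrier P0)" by (simp add: F_def)
  ultimately show "f \<in> coboundaries" using F by (auto simp: coboundaries_def)
next
  assume "f \<in> coboundaries"
  then obtain F where F: "F \<in> lmod_hom R P0 M" and f: "f = (\<lambda>x\<in>carrier P1. F (d0 x))"
    by (auto simp: coboundaries_def)
  have "ann_map f = (\<lambda>a\<in>Ann. a \<odot>\<^bsub>M\<^esub> F p)"
    using p by (auto simp: ann_map_def f lift_Ann lmod_hom_smult[OF F] Ann_closed intro!: restrict_ext)
  then show "ann_map f \<in> inner_Ann"
    using lmod_hom_closed[OF F p] by (auto simp: inner_Ann_def)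
qed

lemma Ext_1_iso:
  "pointwise_group (carrier P1) M cocycles Mod coboundaries \<cong> pointwise_group Ann M hom_Ann Mod inner_Ann"
proof (rule FactGroup_isoI[OF _ hom_Ann_pointwise inner_Ann_subgroup ann_map_hom])
  show "group (pointwise_group (carrier P1) M cocycles)"
    using cocycles_pointwise by (rule comm_group.axioms)
qed (use ann_map_surj ann_map_ker coboundaries_subset in \<open>auto simp: pointwise_group_def\<close>)

end

section \<open>The inverse monoid S(G)\<close>

locale par_group = group G for G :: "('g, 'b) monoid_scheme" (structure)
begin

abbreviation S :: "'g list set monoid" where "S \<equiv> par_monoid G"

section \<open>Words, their classes and the monoid structure\<close>

lemma par_eq_words:
  "par_eq G u v \<Longrightarrow> u \<in> lists (carrier G) - {[]} \<and> v \<in> lists (carrier G) - {[]}"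
  by (induction rule: par_eq.induct) auto

lemma par_class_eq_iff:
  assumes "u \<in> lists (carrier G) - {[]}"
  shows "par_class G u = par_class G v \<longleftrightarrow> par_eq G u v"
proof
  assume "par_class G u = par_class G v"
  moreover have "u \<in> par_class G u"
    using assms by (auto simp: par_class_def intro: par_eq.refl)
  ultimately show "par_eq G u v"
    by (auto simp: par_class_def intro: par_eq.sym)
next
  assume "par_eq G u v"
  then have "par_eq G u w \<longleftrightarrow> par_eq G v w" for w
    by (metis par_eq.sym par_eq.trans)
  then show "par_class G u = par_class G v"
    by (simp add: par_class_def)
qed

lemma carrier_S: "carrier S = par_class G ` (lists (carrier G) - {[]})"
  by (simp add: par_monoid_def)

lemma par_class_mult:
  assumes "u \<in> lists (carrier G) - {[]}" "v \<in> lists (carrier G) - {[]}"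
  shows "par_class G u \<otimes>\<^bsub>S\<^esub> par_class G v = par_class G (u @ v)"
proof -
  have "par_eq G u u" "par_eq G v v"
    using assms by (auto intro: par_eq.refl)
  then have "(\<exists>u'. par_eq G u u' \<and> (\<exists>v'. par_eq G v v' \<and> par_eq G (u' @ v') w)) \<longleftrightarrow> par_eq G (u @ v) w" for w
    by (metis par_eq.trans par_eq.cong)
  then show ?thesis
    by (simp add: par_monoid_def par_class_def Bex_def)
qed

lemma gen_closed [simp, intro]: "g \<in> carrier G \<Longrightarrow> par_gen G g \<in> carrier S"
  by (simp add: carrier_S)

lemma one_S: "\<one>\<^bsub>S\<^esub> = par_gen G \<one>"
  by (simp add: par_monoid_def)

lemma gens_mult:
  assumes "g \<in> carrier G" "u \<in> lists (carrier G) - {[]}"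
  shows "par_gen G g \<otimes>\<^bsub>S\<^esub> par_class G u = par_class G (g # u)"
  using par_class_mult[of "[g]" u] assms by simp

lemma par_class_append_one:
  assumes "u \<in> lists (carrier G) - {[]}"
  shows "par_eq G (u @ [\<one>]) u"
\<comment> \<open>Only nonempty words are related to themselves, so \<open>cong\<close> can split
  off a prefix only if the prefix is nonempty.\<close>
proof (cases "butlast u = []")
  case True
  then obtain g where "u = [g]" "g \<in> carrier G"
    using assms by (cases u rule: rev_cases) auto
  then show ?thesis using par_eq.rel_one[of g G] by simp
next
  case False
  obtain v g where u: "u = v @ [g]" using assms by (cases u rule: rev_cases) auto
  with False assms have "par_eq G (v @ [g, \<one>]) (v @ [g])"
    by (intro par_eq.cong par_eq.refl par_eq.rel_one) auto
  then show ?thesis by (simp add: u)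
qed

text \<open>The word \<open>g, g^-1, g\<close> reduces to \<open>1, g\<close> by
  \<open>rel_right\<close> and to \<open>g, 1\<close> by \<open>rel_left\<close>.\<close>

lemma gen_one_mult:
  assumes "g \<in> carrier G" shows "par_eq G [\<one>, g] [g]"
proof -
  have "par_eq G [g, inv g, g] [g \<otimes> inv g, g]"
    using par_eq.rel_right[of g G "inv g"] assms by simp
  then have 1: "par_eq G [g, inv g, g] [\<one>, g]"
    using assms by simp
  have "par_eq G [g, inv g, g] [g, inv g \<otimes> g]"
    using par_eq.rel_left[of "inv g" G g] assms by simp
  then have "par_eq G [g, inv g, g] [g, \<one>]"
    using assms by simp
  with 1 par_eq.rel_one[OF assms] show ?thesis
    by (metis par_eq.sym par_eq.trans)
qed

lemma par_class_Cons_one: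
  assumes "u \<in> lists (carrier G) - {[]}"
  shows "par_eq G (\<one> # u) u"
proof (cases "tl u = []")
  case True
  then obtain g where "u = [g]" "g \<in> carrier G"
    using assms by (cases u) auto
  then show ?thesis using gen_one_mult by simp
next
  case False
  obtain v g where u: "u = g # v" using assms by (cases u) auto
  with False assms have "par_eq G ([\<one>, g] @ v) ([g] @ v)"
    by (intro par_eq.cong par_eq.refl gen_one_mult) auto
  then show ?thesis by (simp add: u)
qed

sublocale S: monoid S
proof
  fix x y z assume "x \<in> carrier S" "y \<in> carrier S" "z \<in> carrier S"
  then obtain u v w where
      *: "u \<in> lists (carrier G) - {[]}" "v \<in> lists (carrier G) - {[]}" "w \<in> lists (carrier G) - {[]}"
      and xyz: "x = par_class G u" "y = par_class G v" "z = par_class G w"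
    by (auto simp: carrier_S)
  have "u @ v \<in> lists (carrier G) - {[]}" "v @ w \<in> lists (carrier G) - {[]}"
    using * by auto
  with * show "x \<otimes>\<^bsub>S\<^esub> y \<in> carrier S" "x \<otimes>\<^bsub>S\<^esub> y \<otimes>\<^bsub>S\<^esub> z = x \<otimes>\<^bsub>S\<^esub> (y \<otimes>\<^bsub>S\<^esub> z)"
    unfolding xyz by (simp_all add: par_class_mult carrier_S)
next
  show "\<one>\<^bsub>S\<^esub> \<in> carrier S" by (simp add: one_S)
next
  fix x assume "x \<in> carrier S"
  then obtain u where u: "u \<in> lists (carrier G) - {[]}" and x: "x = par_class G u"
    by (auto simp: carrier_S)
  show "\<one>\<^bsub>S\<^esub> \<otimes>\<^bsub>S\<^esub> x = x"
    using par_class_Cons_one[OF u] u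
    by (simp add: x one_S gens_mult par_class_eq_iff)
  show "x \<otimes>\<^bsub>S\<^esub> \<one>\<^bsub>S\<^esub> = x"
    using par_class_append_one[OF u] u
    by (simp add: x one_S par_class_mult par_class_eq_iff)
qed

text \<open>Induction on a representing word. There is no empty word, so the single letter
  \<open>[g]\<close> is reached as \<open>[g]\<close> times the identity.\<close>

lemma S_induct [consumes 1, case_names one gen]:
  assumes "s \<in> carrier S" and one: "P \<one>\<^bsub>S\<^esub>"
    and gen: "\<And>g s. \<lbrakk>g \<in> carrier G; s \<in> carrier S; P s\<rbrakk> \<Longrightarrow> P (par_gen G g \<otimes>\<^bsub>S\<^esub> s)"
  shows "P s"
proof -
  obtain u where "u \<in> lists (carrier G)" "u \<noteq> []" "s = par_class G u"
    using assms(1) by (auto simp: carrier_S)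
  moreover have "u \<in> lists (carrier G) \<Longrightarrow> u \<noteq> [] \<Longrightarrow> P (par_class G u)"
  proof (induction u)
    case (Cons g u)
    show ?case
    proof (cases "u = []")
      case True
      then show ?thesis
        using gen[of g "\<one>\<^bsub>S\<^esub>"] one Cons.prems by simp
    next
      case False
      then have "par_class G (g # u) = par_gen G g \<otimes>\<^bsub>S\<^esub> par_class G u"
        using Cons.prems by (simp add: gens_mult)
      then show ?thesis
        using gen[of g "par_class G u"] Cons False by (simp add: carrier_S)
    qed
  qed simp
  ultimately show ?thesis by blast
qed

text \<open>This is \<open>rel_left\<close> for the pair \<open>g^-1\<close>, \<open>g h\<close>. It
  replaces a product of two generators by one generator behind an idempotent.\<close>

lemma S_rel_left:
  assumes "g \<in> carrier G" "h \<in> carrier G"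
  shows "par_e G g \<otimes>\<^bsub>S\<^esub> par_gen G (g \<otimes> h) = par_gen G g \<otimes>\<^bsub>S\<^esub> par_gen G h"
proof -
  have "par_eq G [g, inv g, g \<otimes> h] [g, inv g \<otimes> (g \<otimes> h)]"
    using par_eq.rel_left[of "inv g" G "g \<otimes> h"] assms by simp
  then have "par_eq G [g, inv g, g \<otimes> h] [g, h]"
    using assms by (simp add: m_assoc[symmetric])
  then show ?thesis
    using assms by (simp add: par_e_def par_class_mult par_class_eq_iff)
qed

lemma S_rel_right:
  assumes "g \<in> carrier G" "h \<in> carrier G"
  shows "par_gen G g \<otimes>\<^bsub>S\<^esub> par_e G h = par_gen G (g \<otimes> h) \<otimes>\<^bsub>S\<^esub> par_gen G (inv h)"
  using par_eq.rel_right[of g G h] assms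
  by (simp add: par_e_def par_class_mult par_class_eq_iff)

section \<open>The idempotents \<open>e_g\<close> and their products\<close>

lemma e_closed [simp, intro]: "g \<in> carrier G \<Longrightarrow> par_e G g \<in> carrier S"
  by (simp add: par_e_def)

lemma e_gen [simp]: "g \<in> carrier G \<Longrightarrow> par_e G g \<otimes>\<^bsub>S\<^esub> par_gen G g = par_gen G g"
  using S_rel_left[of g \<one>] by (simp flip: one_S)

lemma e_idem: "g \<in> carrier G \<Longrightarrow> par_e G g \<otimes>\<^bsub>S\<^esub> par_e G g = par_e G g"
  using e_gen[of g] by (simp add: par_e_def S.m_assoc[symmetric])

text \<open>Both sides equal \<open>[g h][h^-1]\<close>: the left one by \<open>S_rel_right\<close>,
  the right one by \<open>S_rel_left\<close> applied to \<open>g h\<close> and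
  \<open>h^-1\<close>.\<close>

lemma gen_e:
  assumes "g \<in> carrier G" "h \<in> carrier G"
  shows "par_gen G g \<otimes>\<^bsub>S\<^esub> par_e G h = par_e G (g \<otimes> h) \<otimes>\<^bsub>S\<^esub> par_gen G g"
proof -
  have "par_e G (g \<otimes> h) \<otimes>\<^bsub>S\<^esub> par_gen G (g \<otimes> h \<otimes> inv h) = par_gen G (g \<otimes> h) \<otimes>\<^bsub>S\<^esub> par_gen G (inv h)"
    using assms by (intro S_rel_left) auto
  moreover have "g \<otimes> h \<otimes> inv h = g" using assms by (simp add: m_assoc)
  ultimately show ?thesis using assms by (simp add: S_rel_right)
qed

text \<open>Write \<open>e_g = [g][g^-1]\<close> and move \<open>e_h\<close> leftwards by
  \<open>gen_e\<close>: past \<open>[g^-1]\<close> it becomes the idempotent of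
  \<open>g^-1 h\<close>, and past \<open>[g]\<close> it becomes \<open>e_h\<close> again.\<close>

lemma e_commute:
  assumes "g \<in> carrier G" "h \<in> carrier G"
  shows "par_e G g \<otimes>\<^bsub>S\<^esub> par_e G h = par_e G h \<otimes>\<^bsub>S\<^esub> par_e G g"
proof -
  let ?k = "inv g \<otimes> h"
  have k: "g \<otimes> ?k = h" using assms by (simp add: m_assoc[symmetric])
  have "par_e G g \<otimes>\<^bsub>S\<^esub> par_e G h = par_gen G g \<otimes>\<^bsub>S\<^esub> (par_gen G (inv g) \<otimes>\<^bsub>S\<^esub> par_e G h)"
    using assms by (simp add: par_e_def[of G g] S.m_assoc)
  also have "par_gen G (inv g) \<otimes>\<^bsub>S\<^esub> par_e G h = par_e G ?k \<otimes>\<^bsub>S\<^esub> par_gen G (inv g)"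
    using assms by (simp add: gen_e)
  also have "par_gen G g \<otimes>\<^bsub>S\<^esub> (par_e G ?k \<otimes>\<^bsub>S\<^esub> par_gen G (inv g))
      = (par_gen G g \<otimes>\<^bsub>S\<^esub> par_e G ?k) \<otimes>\<^bsub>S\<^esub> par_gen G (inv g)"
    using assms by (simp add: S.m_assoc)
  also have "\<dots> = par_e G h \<otimes>\<^bsub>S\<^esub> par_gen G g \<otimes>\<^bsub>S\<^esub> par_gen G (inv g)"
    using gen_e[of g ?k] assms by (simp only: k m_closed inv_closed)
  also have "\<dots> = par_e G h \<otimes>\<^bsub>S\<^esub> par_e G g"
    using assms by (simp add: par_e_def[of G g] S.m_assoc)
  finally show ?thesis .
qed

text \<open>Products of the \<open>e_g\<close>, for which commutation follows by induction on the
  factors. That every idempotent is of this kind needs the degree map and is shown in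
  \<open>idempotents_S\<close>.\<close>

inductive_set pidem :: "'g list set set" where
  one: "\<one>\<^bsub>S\<^esub> \<in> pidem"
| mult: "\<lbrakk>g \<in> carrier G; e \<in> pidem\<rbrakk> \<Longrightarrow> par_e G g \<otimes>\<^bsub>S\<^esub> e \<in> pidem"

lemma pidem_closed [simp, intro]: "e \<in> pidem \<Longrightarrow> e \<in> carrier S"
  by (induction rule: pidem.induct) auto

lemma pidem_e_commute:
  "\<lbrakk>e \<in> pidem; g \<in> carrier G\<rbrakk> \<Longrightarrow> e \<otimes>\<^bsub>S\<^esub> par_e G g = par_e G g \<otimes>\<^bsub>S\<^esub> e"
proof (induction rule: pidem.induct)
  case (mult h e)
  then have "par_e G h \<otimes>\<^bsub>S\<^esub> e \<otimes>\<^bsub>S\<^esub> par_e G g = (par_e G h \<otimes>\<^bsub>S\<^esub> par_e G g) \<otimes>\<^bsub>S\<^esub> e"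
    by (simp add: S.m_assoc)
  also have "\<dots> = par_e G g \<otimes>\<^bsub>S\<^esub> (par_e G h \<otimes>\<^bsub>S\<^esub> e)"
    using mult by (simp add: e_commute[of h g] S.m_assoc)
  finally show ?case .
qed simp

lemma pidem_commute: "\<lbrakk>e \<in> pidem; f \<in> pidem\<rbrakk> \<Longrightarrow> e \<otimes>\<^bsub>S\<^esub> f = f \<otimes>\<^bsub>S\<^esub> e"
proof (induction rule: pidem.induct)
  case (mult h e)
  then have "par_e G h \<otimes>\<^bsub>S\<^esub> e \<otimes>\<^bsub>S\<^esub> f = (par_e G h \<otimes>\<^bsub>S\<^esub> f) \<otimes>\<^bsub>S\<^esub> e"
    by (simp add: S.m_assoc)
  then show ?case
    using mult by (simp add: pidem_e_commute[symmetric] S.m_assoc)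
qed simp

lemma pidem_mult: "\<lbrakk>e \<in> pidem; f \<in> pidem\<rbrakk> \<Longrightarrow> e \<otimes>\<^bsub>S\<^esub> f \<in> pidem"
  by (induction rule: pidem.induct) (auto simp: S.m_assoc intro: pidem.mult)

lemma pidem_e: "g \<in> carrier G \<Longrightarrow> par_e G g \<in> pidem"
  using pidem.mult[OF _ pidem.one, of g] by simp

lemma pidem_idem: "e \<in> pidem \<Longrightarrow> e \<otimes>\<^bsub>S\<^esub> e = e"
proof (induction rule: pidem.induct)
  case (mult g e)
  have "par_e G g \<otimes>\<^bsub>S\<^esub> e \<otimes>\<^bsub>S\<^esub> (par_e G g \<otimes>\<^bsub>S\<^esub> e) = par_e G g \<otimes>\<^bsub>S\<^esub> (e \<otimes>\<^bsub>S\<^esub> par_e G g) \<otimes>\<^bsub>S\<^esub> e"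
    using mult by (simp add: S.m_assoc)
  also have "\<dots> = (par_e G g \<otimes>\<^bsub>S\<^esub> par_e G g) \<otimes>\<^bsub>S\<^esub> (e \<otimes>\<^bsub>S\<^esub> e)"
    using mult by (simp add: pidem_e_commute S.m_assoc)
  finally show ?case using mult by (simp add: e_idem)
qed simp

lemma gen_pidem:
  "\<lbrakk>e \<in> pidem; g \<in> carrier G\<rbrakk> \<Longrightarrow> \<exists>f\<in>pidem. par_gen G g \<otimes>\<^bsub>S\<^esub> e = f \<otimes>\<^bsub>S\<^esub> par_gen G g"
proof (induction rule: pidem.induct)
  case one
  then show ?case using pidem.one by (intro bexI[of _ "\<one>\<^bsub>S\<^esub>"]) auto
next
  case (mult h e)
  then obtain f where f: "f \<in> pidem" "par_gen G g \<otimes>\<^bsub>S\<^esub> e = f \<otimes>\<^bsub>S\<^esub> par_gen G g" by blast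
  have "par_gen G g \<otimes>\<^bsub>S\<^esub> (par_e G h \<otimes>\<^bsub>S\<^esub> e) = par_gen G g \<otimes>\<^bsub>S\<^esub> par_e G h \<otimes>\<^bsub>S\<^esub> e"
    using mult by (simp add: S.m_assoc)
  also have "\<dots> = par_e G (g \<otimes> h) \<otimes>\<^bsub>S\<^esub> (par_gen G g \<otimes>\<^bsub>S\<^esub> e)"
    using mult by (simp add: gen_e S.m_assoc)
  also have "\<dots> = par_e G (g \<otimes> h) \<otimes>\<^bsub>S\<^esub> f \<otimes>\<^bsub>S\<^esub> par_gen G g"
    using mult f by (simp add: S.m_assoc)
  finally show ?case using mult f by (intro bexI[of _ "par_e G (g \<otimes> h) \<otimes>\<^bsub>S\<^esub> f"]) (auto intro: pidem.mult)
qed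

section \<open>The degree map to \<open>G\<close> and the normal form of an element\<close>

definition word_prod :: "'g list \<Rightarrow> 'g" where "word_prod u = foldr (\<otimes>) u \<one>"

lemma word_prod_closed: "u \<in> lists (carrier G) \<Longrightarrow> word_prod u \<in> carrier G"
  by (induction u) (auto simp: word_prod_def)

lemma word_prod_append:
  "\<lbrakk>u \<in> lists (carrier G); v \<in> lists (carrier G)\<rbrakk> \<Longrightarrow> word_prod (u @ v) = word_prod u \<otimes> word_prod v"
proof (induction u)
  case Nil
  then show ?case using word_prod_closed[of v] by (simp add: word_prod_def)
next
  case (Cons g u)
  then show ?case using word_prod_closed[of u] word_prod_closed[of v]
    by (simp add: word_prod_def m_assoc)
qed

lemma word_prod_cong: "par_eq G u v \<Longrightarrow> word_prod u = word_prod v"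
proof (induction rule: par_eq.induct)
  case (cong u u' v v')
  then show ?case using par_eq_words[OF cong.hyps(1)] par_eq_words[OF cong.hyps(2)]
    by (auto simp: word_prod_append)
qed (auto simp: word_prod_def m_assoc)

text \<open>The homomorphism from \<open>S(G)\<close> to \<open>G\<close> with
  \<open>[g] \<mapsto> g\<close>. The chosen word is immaterial because the defining relations hold
  in \<open>G\<close>.\<close>

definition deg :: "'g list set \<Rightarrow> 'g" where "deg s = word_prod (SOME u. u \<in> s)"

lemma deg_class:
  assumes "u \<in> lists (carrier G) - {[]}" shows "deg (par_class G u) = word_prod u"
proof -
  have "u \<in> par_class G u"
    using assms by (auto simp: par_class_def intro: par_eq.refl)
  then have "(SOME v. v \<in> par_class G u) \<in> par_class G u" by (rule someI)
  then show ?thesis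
    using word_prod_cong by (simp add: deg_def par_class_def)
qed

lemma deg_gen [simp]: "g \<in> carrier G \<Longrightarrow> deg (par_gen G g) = g"
  by (simp add: deg_class word_prod_def)

lemma deg_one [simp]: "deg \<one>\<^bsub>S\<^esub> = \<one>"
  by (simp add: one_S)

lemma deg_closed [simp, intro]: "s \<in> carrier S \<Longrightarrow> deg s \<in> carrier G"
  unfolding carrier_S using deg_class word_prod_closed by fastforce

lemma deg_mult [simp]: "\<lbrakk>s \<in> carrier S; t \<in> carrier S\<rbrakk> \<Longrightarrow> deg (s \<otimes>\<^bsub>S\<^esub> t) = deg s \<otimes> deg t"
proof -
  assume "s \<in> carrier S" "t \<in> carrier S"
  then obtain u v where u: "u \<in> lists (carrier G) - {[]}" "s = par_class G u"
      and v: "v \<in> lists (carrier G) - {[]}" "t = par_class G v"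
    by (auto simp: carrier_S)
  then have "u @ v \<in> lists (carrier G) - {[]}" by auto
  with u v show ?thesis
    by (simp add: par_class_mult deg_class word_prod_append)
qed

text \<open>If \<open>s = e [h]\<close>, then \<open>[g] e [h] = f [g][h]\<close> for some
  idempotent \<open>f\<close>, and \<open>[g][h] = e_g [g h]\<close> collects the two
  generators.\<close>

lemma S_decomp: "s \<in> carrier S \<Longrightarrow> \<exists>e\<in>pidem. s = e \<otimes>\<^bsub>S\<^esub> par_gen G (deg s)"
proof (induction rule: S_induct)
  case one
  then show ?case using pidem.one by (intro bexI[of _ "\<one>\<^bsub>S\<^esub>"]) (auto simp flip: one_S)
next
  case (gen g s)
  let ?h = "deg s"
  from gen obtain e where e: "e \<in> pidem" "s = e \<otimes>\<^bsub>S\<^esub> par_gen G ?h" by blast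
  obtain f where f: "f \<in> pidem" "par_gen G g \<otimes>\<^bsub>S\<^esub> e = f \<otimes>\<^bsub>S\<^esub> par_gen G g"
    using gen_pidem[OF e(1) gen(1)] by blast
  have "par_gen G g \<otimes>\<^bsub>S\<^esub> s = par_gen G g \<otimes>\<^bsub>S\<^esub> (e \<otimes>\<^bsub>S\<^esub> par_gen G ?h)"
    using e(2) by (rule arg_cong)
  also have "\<dots> = par_gen G g \<otimes>\<^bsub>S\<^esub> e \<otimes>\<^bsub>S\<^esub> par_gen G ?h"
    using gen e(1) by (simp add: S.m_assoc)
  also have "\<dots> = f \<otimes>\<^bsub>S\<^esub> (par_gen G g \<otimes>\<^bsub>S\<^esub> par_gen G ?h)"
    using gen e(1) f by (simp add: S.m_assoc)
  also have "\<dots> = f \<otimes>\<^bsub>S\<^esub> par_e G g \<otimes>\<^bsub>S\<^esub> par_gen G (g \<otimes> ?h)"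
    using gen f(1) by (simp add: S_rel_left[symmetric] S.m_assoc)
  finally have "par_gen G g \<otimes>\<^bsub>S\<^esub> s = f \<otimes>\<^bsub>S\<^esub> par_e G g \<otimes>\<^bsub>S\<^esub> par_gen G (deg (par_gen G g \<otimes>\<^bsub>S\<^esub> s))"
    by (subst deg_mult) (use gen in auto)
  moreover have "f \<otimes>\<^bsub>S\<^esub> par_e G g \<in> pidem"
    using gen f(1) by (intro pidem_mult pidem_e)
  ultimately show ?case by blast
qed

text \<open>The degree of an idempotent is an idempotent of the group \<open>G\<close>, hence
  \<open>1\<close>, and the normal form reduces to its idempotent factor.\<close>

lemma idempotents_S: "idempotents S = pidem"
proof
  show "pidem \<subseteq> idempotents S"
    by (auto simp: idempotents_def pidem_idem)
  show "idempotents S \<subseteq> pidem"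
  proof
    fix s assume "s \<in> idempotents S"
    then have s: "s \<in> carrier S" "s \<otimes>\<^bsub>S\<^esub> s = s" by (auto simp: idempotents_def)
    then have "deg s \<otimes> deg s = deg s" using deg_mult[of s s] by simp
    then have "deg s = \<one>" using s by (simp add: r_cancel_one)
    then show "s \<in> pidem" using S_decomp[OF s(1)] by (auto simp flip: one_S)
  qed
qed

lemma pidem_iff: "e \<in> pidem \<longleftrightarrow> e \<in> carrier S \<and> e \<otimes>\<^bsub>S\<^esub> e = e"
  unfolding idempotents_S[symmetric] idempotents_def by simp

section \<open>Existence and uniqueness of inverses\<close>

lemma regular_pidem:
  assumes c: "s \<in> carrier S" "t \<in> carrier S" and t: "s \<otimes>\<^bsub>S\<^esub> t \<otimes>\<^bsub>S\<^esub> s = s"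
  shows "s \<otimes>\<^bsub>S\<^esub> t \<in> pidem" "t \<otimes>\<^bsub>S\<^esub> s \<in> pidem"
proof -
  have "s \<otimes>\<^bsub>S\<^esub> t \<otimes>\<^bsub>S\<^esub> (s \<otimes>\<^bsub>S\<^esub> t) = (s \<otimes>\<^bsub>S\<^esub> t \<otimes>\<^bsub>S\<^esub> s) \<otimes>\<^bsub>S\<^esub> t"
    using c by (simp only: S.m_assoc S.m_closed)
  then show "s \<otimes>\<^bsub>S\<^esub> t \<in> pidem" using c t by (simp add: pidem_iff)
  have "t \<otimes>\<^bsub>S\<^esub> s \<otimes>\<^bsub>S\<^esub> (t \<otimes>\<^bsub>S\<^esub> s) = t \<otimes>\<^bsub>S\<^esub> (s \<otimes>\<^bsub>S\<^esub> t \<otimes>\<^bsub>S\<^esub> s)"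
    using c by (simp only: S.m_assoc S.m_closed)
  then show "t \<otimes>\<^bsub>S\<^esub> s \<in> pidem" using c t by (simp add: pidem_iff)
qed

definition sinv :: "'g list set \<Rightarrow> 'g list set" where "sinv s = semigroup_inv S s"

text \<open>The usual argument from commuting idempotents:
  \<open>t = t (s u)(s t) = t (s t)(s u) = t s u\<close>, and then
  \<open>t s u = (t s)(u s) u = (u s)(t s) u = u\<close>.\<close>

lemma sinv_unique:
  assumes c: "s \<in> carrier S" "t \<in> carrier S" "u \<in> carrier S"
    and t: "s \<otimes>\<^bsub>S\<^esub> t \<otimes>\<^bsub>S\<^esub> s = s" "t \<otimes>\<^bsub>S\<^esub> s \<otimes>\<^bsub>S\<^esub> t = t"
    and u: "s \<otimes>\<^bsub>S\<^esub> u \<otimes>\<^bsub>S\<^esub> s = s" "u \<otimes>\<^bsub>S\<^esub> s \<otimes>\<^bsub>S\<^esub> u = u"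
  shows "t = u"
proof -
  have idem: "s \<otimes>\<^bsub>S\<^esub> t \<in> pidem" "t \<otimes>\<^bsub>S\<^esub> s \<in> pidem" "s \<otimes>\<^bsub>S\<^esub> u \<in> pidem" "u \<otimes>\<^bsub>S\<^esub> s \<in> pidem"
    using c t u by (simp_all add: regular_pidem)
  have "t = t \<otimes>\<^bsub>S\<^esub> (s \<otimes>\<^bsub>S\<^esub> u \<otimes>\<^bsub>S\<^esub> s) \<otimes>\<^bsub>S\<^esub> t" using t u by simp
  also have "\<dots> = t \<otimes>\<^bsub>S\<^esub> ((s \<otimes>\<^bsub>S\<^esub> u) \<otimes>\<^bsub>S\<^esub> (s \<otimes>\<^bsub>S\<^esub> t))"
    using c by (simp only: S.m_assoc S.m_closed)
  also have "(s \<otimes>\<^bsub>S\<^esub> u) \<otimes>\<^bsub>S\<^esub> (s \<otimes>\<^bsub>S\<^esub> t) = (s \<otimes>\<^bsub>S\<^esub> t) \<otimes>\<^bsub>S\<^esub> (s \<otimes>\<^bsub>S\<^esub> u)"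
    using idem(3,1) by (rule pidem_commute)
  also have "t \<otimes>\<^bsub>S\<^esub> ((s \<otimes>\<^bsub>S\<^esub> t) \<otimes>\<^bsub>S\<^esub> (s \<otimes>\<^bsub>S\<^esub> u)) = (t \<otimes>\<^bsub>S\<^esub> (s \<otimes>\<^bsub>S\<^esub> t \<otimes>\<^bsub>S\<^esub> s)) \<otimes>\<^bsub>S\<^esub> u"
    using c by (simp only: S.m_assoc S.m_closed)
  also have "\<dots> = t \<otimes>\<^bsub>S\<^esub> s \<otimes>\<^bsub>S\<^esub> (u \<otimes>\<^bsub>S\<^esub> s \<otimes>\<^bsub>S\<^esub> u)" using t u by simp
  also have "\<dots> = ((t \<otimes>\<^bsub>S\<^esub> s) \<otimes>\<^bsub>S\<^esub> (u \<otimes>\<^bsub>S\<^esub> s)) \<otimes>\<^bsub>S\<^esub> u"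
    using c by (simp only: S.m_assoc S.m_closed)
  also have "(t \<otimes>\<^bsub>S\<^esub> s) \<otimes>\<^bsub>S\<^esub> (u \<otimes>\<^bsub>S\<^esub> s) = (u \<otimes>\<^bsub>S\<^esub> s) \<otimes>\<^bsub>S\<^esub> (t \<otimes>\<^bsub>S\<^esub> s)"
    using idem(2,4) by (rule pidem_commute)
  also have "(u \<otimes>\<^bsub>S\<^esub> s) \<otimes>\<^bsub>S\<^esub> (t \<otimes>\<^bsub>S\<^esub> s) \<otimes>\<^bsub>S\<^esub> u = u \<otimes>\<^bsub>S\<^esub> (s \<otimes>\<^bsub>S\<^esub> t \<otimes>\<^bsub>S\<^esub> s) \<otimes>\<^bsub>S\<^esub> u"
    using c by (simp only: S.m_assoc S.m_closed)
  also have "\<dots> = u" using t u by simp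
  finally show ?thesis .
qed

lemma sinv_eqI:
  assumes "s \<in> carrier S" "t \<in> carrier S"
    and "s \<otimes>\<^bsub>S\<^esub> t \<otimes>\<^bsub>S\<^esub> s = s" "t \<otimes>\<^bsub>S\<^esub> s \<otimes>\<^bsub>S\<^esub> t = t"
  shows "sinv s = t"
  unfolding sinv_def semigroup_inv_def
proof (rule the_equality)
  show "t \<in> carrier S \<and> s \<otimes>\<^bsub>S\<^esub> t \<otimes>\<^bsub>S\<^esub> s = s \<and> t \<otimes>\<^bsub>S\<^esub> s \<otimes>\<^bsub>S\<^esub> t = t"
    by (intro conjI assms)
  fix u assume "u \<in> carrier S \<and> s \<otimes>\<^bsub>S\<^esub> u \<otimes>\<^bsub>S\<^esub> s = s \<and> u \<otimes>\<^bsub>S\<^esub> s \<otimes>\<^bsub>S\<^esub> u = u"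
  then show "u = t"
    by (elim conjE) (rule sinv_unique[OF assms(1) _ assms(2) _ _ assms(3,4)])
qed

text \<open>An inverse can be read off from any normal form \<open>e [g]\<close>: the candidate
  \<open>[g^-1] e\<close> works because \<open>e\<close> commutes with \<open>e_g\<close>.\<close>

lemma sinv_decomp:
  assumes e: "e \<in> pidem" and g: "g \<in> carrier G" and s: "s = e \<otimes>\<^bsub>S\<^esub> par_gen G g"
  shows "sinv s = par_gen G (inv g) \<otimes>\<^bsub>S\<^esub> e"
    and "s \<otimes>\<^bsub>S\<^esub> sinv s = e \<otimes>\<^bsub>S\<^esub> par_e G g"
    and "s \<otimes>\<^bsub>S\<^esub> sinv s \<otimes>\<^bsub>S\<^esub> s = s"
    and "sinv s \<otimes>\<^bsub>S\<^esub> s \<otimes>\<^bsub>S\<^esub> sinv s = sinv s"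
proof -
  let ?t = "par_gen G (inv g) \<otimes>\<^bsub>S\<^esub> e"
  have c: "s \<in> carrier S" "?t \<in> carrier S" using e g s by auto
  have "s \<otimes>\<^bsub>S\<^esub> ?t = e \<otimes>\<^bsub>S\<^esub> (par_e G g \<otimes>\<^bsub>S\<^esub> e)"
    using e g by (simp add: s par_e_def S.m_assoc)
  also have "\<dots> = (e \<otimes>\<^bsub>S\<^esub> e) \<otimes>\<^bsub>S\<^esub> par_e G g"
    using e g by (simp add: S.m_assoc pidem_e_commute)
  finally have st: "s \<otimes>\<^bsub>S\<^esub> ?t = e \<otimes>\<^bsub>S\<^esub> par_e G g"
    using e by (simp add: pidem_idem)
  have "s \<otimes>\<^bsub>S\<^esub> ?t \<otimes>\<^bsub>S\<^esub> s = (e \<otimes>\<^bsub>S\<^esub> par_e G g) \<otimes>\<^bsub>S\<^esub> e \<otimes>\<^bsub>S\<^esub> par_gen G g"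
    unfolding st using e g by (simp add: s S.m_assoc)
  also have "\<dots> = e \<otimes>\<^bsub>S\<^esub> (par_e G g \<otimes>\<^bsub>S\<^esub> e) \<otimes>\<^bsub>S\<^esub> par_gen G g"
    using e g by (simp add: S.m_assoc)
  also have "par_e G g \<otimes>\<^bsub>S\<^esub> e = e \<otimes>\<^bsub>S\<^esub> par_e G g"
    using e g by (rule pidem_e_commute[symmetric])
  also have "e \<otimes>\<^bsub>S\<^esub> (e \<otimes>\<^bsub>S\<^esub> par_e G g) \<otimes>\<^bsub>S\<^esub> par_gen G g = e \<otimes>\<^bsub>S\<^esub> e \<otimes>\<^bsub>S\<^esub> (par_e G g \<otimes>\<^bsub>S\<^esub> par_gen G g)"
    using e g by (simp add: S.m_assoc)
  also have "\<dots> = s" using e g by (simp add: s pidem_idem)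
  finally have 1: "s \<otimes>\<^bsub>S\<^esub> ?t \<otimes>\<^bsub>S\<^esub> s = s" .
  have "?t \<otimes>\<^bsub>S\<^esub> s \<otimes>\<^bsub>S\<^esub> ?t = par_gen G (inv g) \<otimes>\<^bsub>S\<^esub> (e \<otimes>\<^bsub>S\<^esub> (e \<otimes>\<^bsub>S\<^esub> par_e G g))"
    using c e g st by (simp add: S.m_assoc)
  also have "\<dots> = par_gen G (inv g) \<otimes>\<^bsub>S\<^esub> ((e \<otimes>\<^bsub>S\<^esub> e) \<otimes>\<^bsub>S\<^esub> par_e G g)"
    using e g by (simp add: S.m_assoc)
  also have "\<dots> = (par_gen G (inv g) \<otimes>\<^bsub>S\<^esub> par_e G g) \<otimes>\<^bsub>S\<^esub> e"
    using e g by (simp add: pidem_idem pidem_e_commute S.m_assoc)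
  also have "par_gen G (inv g) \<otimes>\<^bsub>S\<^esub> par_e G g = par_gen G (inv g)"
    using g e_gen[of "inv g"] by (simp add: par_e_def S.m_assoc)
  finally have 2: "?t \<otimes>\<^bsub>S\<^esub> s \<otimes>\<^bsub>S\<^esub> ?t = ?t" .
  show *: "sinv s = ?t" by (rule sinv_eqI[OF c 1 2])
  show "s \<otimes>\<^bsub>S\<^esub> sinv s = e \<otimes>\<^bsub>S\<^esub> par_e G g"
    "s \<otimes>\<^bsub>S\<^esub> sinv s \<otimes>\<^bsub>S\<^esub> s = s" "sinv s \<otimes>\<^bsub>S\<^esub> s \<otimes>\<^bsub>S\<^esub> sinv s = sinv s"
    using st 1 2 * by auto
qed

lemma sinv_closed [simp, intro]: "s \<in> carrier S \<Longrightarrow> sinv s \<in> carrier S"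
  using S_decomp[of s] sinv_decomp(1)[of _ "deg s" s] by auto

lemma sinv_regular:
  assumes "s \<in> carrier S"
  shows "s \<otimes>\<^bsub>S\<^esub> sinv s \<otimes>\<^bsub>S\<^esub> s = s" "sinv s \<otimes>\<^bsub>S\<^esub> s \<otimes>\<^bsub>S\<^esub> sinv s = sinv s"
  using S_decomp[OF assms] sinv_decomp(3,4)[of _ "deg s" s] assms by blast+

section \<open>The range idempotent of an element\<close>

definition rng :: "'g list set \<Rightarrow> 'g list set" where "rng s = s \<otimes>\<^bsub>S\<^esub> sinv s"

lemma rng_pidem [simp, intro]: "s \<in> carrier S \<Longrightarrow> rng s \<in> pidem"
  unfolding rng_def by (simp add: regular_pidem sinv_regular)

text \<open>The normal form made canonical: of the possible idempotent factors \<open>e\<close>, the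
  product \<open>e e_g\<close> does not depend on the choice, since it equals \<open>s s^-1\<close>.
  It absorbs a further \<open>e_g\<close>.\<close>

lemma rng_deg:
  assumes "s \<in> carrier S"
  shows "rng s \<otimes>\<^bsub>S\<^esub> par_e G (deg s) = rng s" "rng s \<otimes>\<^bsub>S\<^esub> par_gen G (deg s) = s"
proof -
  obtain e where e: "e \<in> pidem" "s = e \<otimes>\<^bsub>S\<^esub> par_gen G (deg s)"
    using S_decomp[OF assms] by blast
  have r: "rng s = e \<otimes>\<^bsub>S\<^esub> par_e G (deg s)"
    using sinv_decomp(2)[OF e(1) _ e(2)] assms by (simp add: rng_def)
  show "rng s \<otimes>\<^bsub>S\<^esub> par_e G (deg s) = rng s" "rng s \<otimes>\<^bsub>S\<^esub> par_gen G (deg s) = s"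
    using e assms by (simp_all add: r S.m_assoc e_idem)
qed

lemma rng_left: "s \<in> carrier S \<Longrightarrow> rng s \<otimes>\<^bsub>S\<^esub> s = s"
  by (simp add: rng_def sinv_regular)

lemma rng_of_pidem: "e \<in> pidem \<Longrightarrow> rng e = e"
  using sinv_eqI[of e e] by (simp add: rng_def pidem_idem)

lemma deg_pidem: "e \<in> pidem \<Longrightarrow> deg e = \<one>"
  using deg_mult[of e e] pidem_idem[of e] r_cancel_one[of "deg e" "deg e"] by auto

lemma rng_gen: "g \<in> carrier G \<Longrightarrow> rng (par_gen G g) = par_e G g"
  using sinv_decomp(2)[OF pidem.one, of g "par_gen G g"] by (simp add: rng_def)

lemma sinv_rng_commute:
  assumes "s \<in> carrier S" "e \<in> pidem"
  shows "s \<otimes>\<^bsub>S\<^esub> e \<otimes>\<^bsub>S\<^esub> sinv s \<otimes>\<^bsub>S\<^esub> s = s \<otimes>\<^bsub>S\<^esub> e"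
proof -
  have "sinv s \<otimes>\<^bsub>S\<^esub> s \<in> pidem"
    using assms by (simp add: regular_pidem sinv_regular)
  then have "e \<otimes>\<^bsub>S\<^esub> (sinv s \<otimes>\<^bsub>S\<^esub> s) = sinv s \<otimes>\<^bsub>S\<^esub> s \<otimes>\<^bsub>S\<^esub> e"
    using assms by (simp add: pidem_commute)
  then have "s \<otimes>\<^bsub>S\<^esub> e \<otimes>\<^bsub>S\<^esub> sinv s \<otimes>\<^bsub>S\<^esub> s = s \<otimes>\<^bsub>S\<^esub> (sinv s \<otimes>\<^bsub>S\<^esub> s \<otimes>\<^bsub>S\<^esub> e)"
    using assms by (simp add: S.m_assoc)
  also have "\<dots> = s \<otimes>\<^bsub>S\<^esub> sinv s \<otimes>\<^bsub>S\<^esub> s \<otimes>\<^bsub>S\<^esub> e"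
    using assms by (simp add: S.m_assoc)
  finally show ?thesis using sinv_regular[OF assms(1)] by simp
qed

text \<open>\<open>t^-1 s^-1\<close> is the inverse of \<open>s t\<close> because
  \<open>s^-1 s\<close> and \<open>t t^-1\<close> commute. The formula says that \<open>rng\<close>
  turns left multiplication by \<open>s\<close> into the action of \<open>s\<close> on
  \<open>B\<close>.\<close>

lemma rng_mult:
  assumes "s \<in> carrier S" "t \<in> carrier S"
  shows "rng (s \<otimes>\<^bsub>S\<^esub> t) = s \<otimes>\<^bsub>S\<^esub> rng t \<otimes>\<^bsub>S\<^esub> sinv s"
proof -
  let ?u = "sinv t \<otimes>\<^bsub>S\<^esub> sinv s"
  have a: "s \<otimes>\<^bsub>S\<^esub> t \<otimes>\<^bsub>S\<^esub> ?u = s \<otimes>\<^bsub>S\<^esub> rng t \<otimes>\<^bsub>S\<^esub> sinv s"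
    using assms by (simp add: rng_def S.m_assoc)
  have "s \<otimes>\<^bsub>S\<^esub> t \<otimes>\<^bsub>S\<^esub> ?u \<otimes>\<^bsub>S\<^esub> (s \<otimes>\<^bsub>S\<^esub> t) = s \<otimes>\<^bsub>S\<^esub> rng t \<otimes>\<^bsub>S\<^esub> sinv s \<otimes>\<^bsub>S\<^esub> s \<otimes>\<^bsub>S\<^esub> t"
    using assms unfolding a by (simp add: S.m_assoc)
  also have "\<dots> = s \<otimes>\<^bsub>S\<^esub> rng t \<otimes>\<^bsub>S\<^esub> t"
    using assms by (simp add: sinv_rng_commute)
  finally have 1: "s \<otimes>\<^bsub>S\<^esub> t \<otimes>\<^bsub>S\<^esub> ?u \<otimes>\<^bsub>S\<^esub> (s \<otimes>\<^bsub>S\<^esub> t) = s \<otimes>\<^bsub>S\<^esub> t"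
    using assms by (simp add: S.m_assoc rng_left)
  have ss: "sinv s \<otimes>\<^bsub>S\<^esub> s \<in> pidem"
    using assms by (simp add: regular_pidem sinv_regular)
  have "?u \<otimes>\<^bsub>S\<^esub> (s \<otimes>\<^bsub>S\<^esub> t) \<otimes>\<^bsub>S\<^esub> ?u = sinv t \<otimes>\<^bsub>S\<^esub> ((sinv s \<otimes>\<^bsub>S\<^esub> s) \<otimes>\<^bsub>S\<^esub> rng t) \<otimes>\<^bsub>S\<^esub> sinv s"
    using assms by (simp add: rng_def S.m_assoc)
  also have "(sinv s \<otimes>\<^bsub>S\<^esub> s) \<otimes>\<^bsub>S\<^esub> rng t = rng t \<otimes>\<^bsub>S\<^esub> (sinv s \<otimes>\<^bsub>S\<^esub> s)"
    using ss assms by (simp add: pidem_commute)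
  also have "sinv t \<otimes>\<^bsub>S\<^esub> (rng t \<otimes>\<^bsub>S\<^esub> (sinv s \<otimes>\<^bsub>S\<^esub> s)) \<otimes>\<^bsub>S\<^esub> sinv s
      = (sinv t \<otimes>\<^bsub>S\<^esub> t \<otimes>\<^bsub>S\<^esub> sinv t) \<otimes>\<^bsub>S\<^esub> (sinv s \<otimes>\<^bsub>S\<^esub> s \<otimes>\<^bsub>S\<^esub> sinv s)"
    using assms by (simp add: rng_def S.m_assoc)
  also have "\<dots> = ?u" using assms by (simp add: sinv_regular)
  finally have 2: "?u \<otimes>\<^bsub>S\<^esub> (s \<otimes>\<^bsub>S\<^esub> t) \<otimes>\<^bsub>S\<^esub> ?u = ?u" .
  have "sinv (s \<otimes>\<^bsub>S\<^esub> t) = ?u"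
    using assms 1 2 by (intro sinv_eqI) auto
  then show ?thesis using a by (simp add: rng_def)
qed

text \<open>In the natural order of idempotents \<open>rng (s t)\<close> lies below
  \<open>rng s\<close>. Both equations are used when the derivation identity is multiplied by
  \<open>rng (s t)\<close>.\<close>

lemma rng_mult_absorb:
  assumes "s \<in> carrier S" "t \<in> carrier S"
  shows "rng (s \<otimes>\<^bsub>S\<^esub> t) \<otimes>\<^bsub>S\<^esub> s = s \<otimes>\<^bsub>S\<^esub> rng t"
    and "rng (s \<otimes>\<^bsub>S\<^esub> t) \<otimes>\<^bsub>S\<^esub> rng s = rng (s \<otimes>\<^bsub>S\<^esub> t)"
proof -
  show 1: "rng (s \<otimes>\<^bsub>S\<^esub> t) \<otimes>\<^bsub>S\<^esub> s = s \<otimes>\<^bsub>S\<^esub> rng t"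
    using assms by (simp add: rng_mult sinv_rng_commute)
  have "rng (s \<otimes>\<^bsub>S\<^esub> t) \<otimes>\<^bsub>S\<^esub> rng s = rng (s \<otimes>\<^bsub>S\<^esub> t) \<otimes>\<^bsub>S\<^esub> s \<otimes>\<^bsub>S\<^esub> sinv s"
    using assms by (simp add: rng_def[of s] S.m_assoc)
  then show "rng (s \<otimes>\<^bsub>S\<^esub> t) \<otimes>\<^bsub>S\<^esub> rng s = rng (s \<otimes>\<^bsub>S\<^esub> t)"
    using assms 1 by (simp add: rng_mult)
qed

end

section \<open>Linear extension from the monoid to its algebra\<close>

definition single :: "('k, 'a) ring_scheme \<Rightarrow> 'k \<Rightarrow> 's \<Rightarrow> 's \<Rightarrow> 'k" where
  "single K k s = (\<lambda>t. if t = s then k else \<zero>\<^bsub>K\<^esub>)"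

lemma alg_basis_single: "alg_basis K s = single K \<one>\<^bsub>K\<^esub> s"
  by (simp add: alg_basis_def single_def)

lemma single_apply: "single K k s t = (if t = s then k else \<zero>\<^bsub>K\<^esub>)"
  by (simp add: single_def)

context ring
begin

lemma single_closed: "\<lbrakk>k \<in> carrier R; s \<in> X\<rbrakk> \<Longrightarrow> single R k s \<in> fin_supp_funs R X"
  by (auto simp: fin_supp_funs_def single_apply intro: finite_subset[of _ "{s}"])

lemma bilinear_ext_single:
  assumes "k \<in> carrier R" "l \<in> carrier R"
  shows "bilinear_ext R op (single R k s) (single R l t) = single R (k \<otimes> l) (op s t)"
proof
  fix z
  let ?I = "{(x, y). single R k s x \<noteq> \<zero> \<and> single R l t y \<noteq> \<zero> \<and> op x y = z}"
  show "bilinear_ext R op (single R k s) (single R l t) z = single R (k \<otimes> l) (op s t) z"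
  proof (cases "k \<noteq> \<zero> \<and> l \<noteq> \<zero> \<and> op s t = z")
    case True
    then have "?I = {(s, t)}" by (auto simp: single_apply split: if_splits)
    then show ?thesis using True assms by (simp add: bilinear_ext_def single_apply)
  next
    case False
    then have "?I = {}" by (auto simp: single_apply split: if_splits)
    then show ?thesis using False assms by (auto simp: bilinear_ext_def single_apply)
  qed
qed

lemma fin_supp_induct [consumes 1, case_names zero single add]:
  assumes a: "a \<in> fin_supp_funs R X"
    and zero: "P (\<lambda>_. \<zero>)"
    and single: "\<And>k s. \<lbrakk>k \<in> carrier R; s \<in> X\<rbrakk> \<Longrightarrow> P (single R k s)"
    and add: "\<And>a b. \<lbrakk>a \<in> fin_supp_funs R X; b \<in> fin_supp_funs R X; P a; P b\<rbrakk> \<Longrightarrow> P (\<lambda>s. a s \<oplus> b s)"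
  shows "P a"
proof -
  \<comment> \<open>The set \<open>F\<close> merely contains the support. Thus the induction can
    drop a point \<open>s\<close> even if \<open>a s\<close> is zero or \<open>s\<close> lies
    outside \<open>X\<close>.\<close>
  have "P a" if "finite F" "a \<in> fin_supp_funs R X" "{x. a x \<noteq> \<zero>} \<subseteq> F" for F a
    using that
  proof (induction F arbitrary: a rule: finite_induct)
    case empty
    then have "a = (\<lambda>_. \<zero>)" by auto
    then show ?case using zero by simp
  next
    case (insert s F)
    show ?case
    proof (cases "s \<in> X")
      case True
      let ?b = "a(s := \<zero>)"
      have as: "a s \<in> carrier R" using insert.prems True by (auto simp: fin_supp_funs_def)
      have "{x. ?b x \<noteq> \<zero>} \<subseteq> {x. a x \<noteq> \<zero>}" by auto
      then have b: "?b \<in> fin_supp_funs R X"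
        using insert.prems(1) by (auto simp: fin_supp_funs_def intro: finite_subset)
      have "P ?b" using insert.prems by (intro insert.IH b) auto
      then have "P (\<lambda>x. ?b x \<oplus> single R (a s) s x)"
        using single[OF as True] b single_closed[OF as True] by (intro add)
      moreover have "(\<lambda>x. ?b x \<oplus> single R (a s) s x) = a"
      proof
        fix x
        have "a x \<in> carrier R" using insert.prems(1) by (cases "x \<in> X") (auto simp: fin_supp_funs_def)
        then show "?b x \<oplus> single R (a s) s x = a x"
          using as by (cases "x = s") (simp_all add: single_apply)
      qed
      ultimately show ?thesis by (rule back_subst)
    next
      case False
      then have "a s = \<zero>" using insert.prems(1) by (auto simp: fin_supp_funs_def)
      then show ?thesis using insert.prems by (intro insert.IH) auto
    qed
  qed
  from this[OF _ a] a show ?thesis by (auto simp: fin_supp_funs_def)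
qed

end

text \<open>\<open>F k s\<close> stands for \<open>k\<close> times the value at \<open>s\<close>.
  The target carries no scalar action of \<open>K\<close> of its own, so the coefficient is an
  argument of \<open>F\<close>, and additivity in it replaces linearity.\<close>

definition lin_ext ::
    "('k, 'a) ring_scheme \<Rightarrow> ('m, 'y) ring_scheme \<Rightarrow> ('k \<Rightarrow> 's \<Rightarrow> 'm) \<Rightarrow> ('s \<Rightarrow> 'k) \<Rightarrow> 'm" where
  "lin_ext K M F a = (\<Oplus>\<^bsub>M\<^esub>s\<in>{s. a s \<noteq> \<zero>\<^bsub>K\<^esub>}. F (a s) s)"

locale additive_family = K: ring K + M: abelian_group M
  for K :: "('k, 'a) ring_scheme" and M :: "('m, 'y) ring_scheme"
    and X :: "'s set" and F :: "'k \<Rightarrow> 's \<Rightarrow> 'm" +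
  assumes F_closed: "\<lbrakk>k \<in> carrier K; s \<in> X\<rbrakk> \<Longrightarrow> F k s \<in> carrier M"
    and F_add: "\<lbrakk>k \<in> carrier K; l \<in> carrier K; s \<in> X\<rbrakk> \<Longrightarrow> F (k \<oplus>\<^bsub>K\<^esub> l) s = F k s \<oplus>\<^bsub>M\<^esub> F l s"
begin

lemma F_zero: assumes "s \<in> X" shows "F \<zero>\<^bsub>K\<^esub> s = \<zero>\<^bsub>M\<^esub>"
proof -
  have "F \<zero>\<^bsub>K\<^esub> s \<oplus>\<^bsub>M\<^esub> F \<zero>\<^bsub>K\<^esub> s = F \<zero>\<^bsub>K\<^esub> s"
    using F_add[OF K.zero_closed K.zero_closed assms] by simp
  then show ?thesis
    using F_closed[OF K.zero_closed assms] M.add.r_cancel_one by metis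
qed

text \<open>Lets functions with different supports be summed over one common index set, which is
  what additivity needs.\<close>

lemma lin_ext_superset:
  assumes a: "a \<in> fin_supp_funs K X" and Y: "finite Y" "{s. a s \<noteq> \<zero>\<^bsub>K\<^esub>} \<subseteq> Y" "Y \<subseteq> X"
  shows "lin_ext K M F a = (\<Oplus>\<^bsub>M\<^esub>s\<in>Y. F (a s) s)"
  unfolding lin_ext_def
proof (rule M.add.finprod_mono_neutral_cong_left[OF Y(1,2)])
  show "\<And>i. i \<in> Y - {s. a s \<noteq> \<zero>\<^bsub>K\<^esub>} \<Longrightarrow> F (a i) i = \<zero>\<^bsub>M\<^esub>"
    using Y by (auto simp: F_zero)
  show "(\<lambda>s. F (a s) s) \<in> Y \<rightarrow> carrier M"
    using a Y by (auto simp: fin_supp_funs_def intro!: F_closed)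
qed simp

lemma supp_subset: "a \<in> fin_supp_funs K X \<Longrightarrow> finite {s. a s \<noteq> \<zero>\<^bsub>K\<^esub>} \<and> {s. a s \<noteq> \<zero>\<^bsub>K\<^esub>} \<subseteq> X"
  by (auto simp: fin_supp_funs_def)

lemma lin_ext_closed: "a \<in> fin_supp_funs K X \<Longrightarrow> lin_ext K M F a \<in> carrier M"
  unfolding lin_ext_def using supp_subset[of a]
  by (intro M.finsum_closed) (auto simp: fin_supp_funs_def intro!: F_closed)

lemma lin_ext_add:
  assumes a: "a \<in> fin_supp_funs K X" and b: "b \<in> fin_supp_funs K X"
  shows "lin_ext K M F (\<lambda>s. a s \<oplus>\<^bsub>K\<^esub> b s) = lin_ext K M F a \<oplus>\<^bsub>M\<^esub> lin_ext K M F b"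
proof -
  let ?Y = "{s. a s \<noteq> \<zero>\<^bsub>K\<^esub>} \<union> {s. b s \<noteq> \<zero>\<^bsub>K\<^esub>}"
  have Y: "finite ?Y" "?Y \<subseteq> X" using supp_subset[OF a] supp_subset[OF b] by auto
  have ab: "\<And>s. s \<in> ?Y \<Longrightarrow> a s \<in> carrier K" "\<And>s. s \<in> ?Y \<Longrightarrow> b s \<in> carrier K"
    using a b by (auto simp: fin_supp_funs_def)
  have sub: "{s. a s \<oplus>\<^bsub>K\<^esub> b s \<noteq> \<zero>\<^bsub>K\<^esub>} \<subseteq> ?Y" by auto
  have c: "(\<lambda>s. a s \<oplus>\<^bsub>K\<^esub> b s) \<in> fin_supp_funs K X"
    using a b finite_subset[OF sub Y(1)] by (auto simp: fin_supp_funs_def)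
  have "lin_ext K M F (\<lambda>s. a s \<oplus>\<^bsub>K\<^esub> b s) = (\<Oplus>\<^bsub>M\<^esub>s\<in>?Y. F (a s \<oplus>\<^bsub>K\<^esub> b s) s)"
    using c Y sub by (intro lin_ext_superset) auto
  also have "\<dots> = (\<Oplus>\<^bsub>M\<^esub>s\<in>?Y. F (a s) s \<oplus>\<^bsub>M\<^esub> F (b s) s)"
    using Y(2) ab by (intro M.add.finprod_cong') (auto simp: F_add subset_iff intro!: F_closed M.a_closed)
  also have "\<dots> = (\<Oplus>\<^bsub>M\<^esub>s\<in>?Y. F (a s) s) \<oplus>\<^bsub>M\<^esub> (\<Oplus>\<^bsub>M\<^esub>s\<in>?Y. F (b s) s)"
    using Y(2) ab by (intro M.finsum_addf) (auto simp: subset_iff intro!: F_closed)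
  also have "\<dots> = lin_ext K M F a \<oplus>\<^bsub>M\<^esub> lin_ext K M F b"
    using Y lin_ext_superset[OF a Y(1) _ Y(2)] lin_ext_superset[OF b Y(1) _ Y(2)] by simp
  finally show ?thesis .
qed

lemma lin_ext_single:
  assumes "k \<in> carrier K" "s \<in> X"
  shows "lin_ext K M F (single K k s) = F k s"
proof -
  have "lin_ext K M F (single K k s) = (\<Oplus>\<^bsub>M\<^esub>t\<in>{s}. F (single K k s t) t)"
    using assms by (intro lin_ext_superset K.single_closed) (auto simp: single_apply)
  then show ?thesis using assms by (simp add: single_apply F_closed)
qed

end

lemma single_add: "ring K \<Longrightarrow> k \<in> carrier K \<Longrightarrow> l \<in> carrier K \<Longrightarrow>
    single K (k \<oplus>\<^bsub>K\<^esub> l) s = (\<lambda>t. single K k s t \<oplus>\<^bsub>K\<^esub> single K l s t)"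
  using ring.ring_simprules(8)[of K "\<zero>\<^bsub>K\<^esub>"] by (auto simp: single_apply ring.ring_simprules)

section \<open>Partial derivations as homomorphisms on the annihilator\<close>

locale par_presentation = par_group G + K: cring K +
  cyclic_presentation "Kpar K G" M "Kpar_B K G" P0 P1 P2 d0 d1 eps p \<beta>
  for K :: "('k, 'a) ring_scheme" and G :: "('g, 'b) monoid_scheme" (structure)
    and M :: "('g list set \<Rightarrow> 'k, 'm) module"
    and P0 :: "('g list set \<Rightarrow> 'k, 'p) module" and P1 :: "('g list set \<Rightarrow> 'k, 'p) module"
    and P2 :: "('g list set \<Rightarrow> 'k, 'p) module"
    and d0 d1 eps p \<beta> +
  assumes eps_p_one: "eps p = alg_basis K \<one>\<^bsub>par_monoid G\<^esub>"
begin

section \<open>The partial group algebra and its action on the generator of \<open>B\<close>\<close>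

abbreviation KS :: "('g list set \<Rightarrow> 'k) ring" where "KS \<equiv> Kpar K G"

abbreviation \<delta> :: "'g list set \<Rightarrow> 'g list set \<Rightarrow> 'k" where "\<delta> \<equiv> single K \<one>\<^bsub>K\<^esub>"

lemma carrier_KS: "carrier KS = fin_supp_funs K (carrier S)"
  by (simp add: monoid_algebra_def)

lemma add_KS: "a \<oplus>\<^bsub>KS\<^esub> b = (\<lambda>s. a s \<oplus>\<^bsub>K\<^esub> b s)"
  by (simp add: monoid_algebra_def)

lemma zero_KS: "\<zero>\<^bsub>KS\<^esub> = (\<lambda>_. \<zero>\<^bsub>K\<^esub>)"
  by (simp add: monoid_algebra_def)

lemma one_KS: "\<one>\<^bsub>KS\<^esub> = \<delta> \<one>\<^bsub>S\<^esub>"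
  by (simp add: monoid_algebra_def alg_basis_single)

lemma KS_single_closed [simp, intro]: "\<lbrakk>k \<in> carrier K; s \<in> carrier S\<rbrakk> \<Longrightarrow> single K k s \<in> carrier KS"
  by (simp add: carrier_KS K.single_closed)

lemma KS_single_mult:
  "\<lbrakk>k \<in> carrier K; l \<in> carrier K\<rbrakk> \<Longrightarrow>
    single K k s \<otimes>\<^bsub>KS\<^esub> single K l t = single K (k \<otimes>\<^bsub>K\<^esub> l) (s \<otimes>\<^bsub>S\<^esub> t)"
  by (simp add: monoid_algebra_def K.bilinear_ext_single)

lemma KS_single_add:
  "\<lbrakk>k \<in> carrier K; l \<in> carrier K\<rbrakk> \<Longrightarrow> single K (k \<oplus>\<^bsub>K\<^esub> l) s = single K k s \<oplus>\<^bsub>KS\<^esub> single K l s"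
  by (simp add: add_KS single_add K.ring_axioms)

lemma KS_induct [consumes 1, case_names zero single add]:
  assumes "a \<in> carrier KS" and "P \<zero>\<^bsub>KS\<^esub>"
    and "\<And>k s. \<lbrakk>k \<in> carrier K; s \<in> carrier S\<rbrakk> \<Longrightarrow> P (single K k s)"
    and "\<And>a b. \<lbrakk>a \<in> carrier KS; b \<in> carrier KS; P a; P b\<rbrakk> \<Longrightarrow> P (a \<oplus>\<^bsub>KS\<^esub> b)"
  shows "P a"
  using assms unfolding carrier_KS add_KS zero_KS by (rule K.fin_supp_induct)

lemma lin_ext_KS:
  assumes "abelian_group N"
    and "\<And>k s. \<lbrakk>k \<in> carrier K; s \<in> carrier S\<rbrakk> \<Longrightarrow> F k s \<in> carrier N"
    and "\<And>k l s. \<lbrakk>k \<in> carrier K; l \<in> carrier K; s \<in> carrier S\<rbrakk> \<Longrightarrow> F (k \<oplus>\<^bsub>K\<^esub> l) s = F k s \<oplus>\<^bsub>N\<^esub> F l s"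
  shows "a \<in> carrier KS \<Longrightarrow> lin_ext K N F a \<in> carrier N"
    and "\<lbrakk>a \<in> carrier KS; b \<in> carrier KS\<rbrakk> \<Longrightarrow> lin_ext K N F (a \<oplus>\<^bsub>KS\<^esub> b) = lin_ext K N F a \<oplus>\<^bsub>N\<^esub> lin_ext K N F b"
    and "\<lbrakk>k \<in> carrier K; s \<in> carrier S\<rbrakk> \<Longrightarrow> lin_ext K N F (single K k s) = F k s"
proof -
  interpret N: abelian_group N by fact
  interpret additive_family K N "carrier S" F
    by unfold_locales (use assms in auto)
  show "a \<in> carrier KS \<Longrightarrow> lin_ext K N F a \<in> carrier N"
    "\<lbrakk>a \<in> carrier KS; b \<in> carrier KS\<rbrakk> \<Longrightarrow> lin_ext K N F (a \<oplus>\<^bsub>KS\<^esub> b) = lin_ext K N F a \<oplus>\<^bsub>N\<^esub> lin_ext K N F b"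
    "\<lbrakk>k \<in> carrier K; s \<in> carrier S\<rbrakk> \<Longrightarrow> lin_ext K N F (single K k s) = F k s"
    using lin_ext_closed lin_ext_add lin_ext_single by (simp_all add: carrier_KS add_KS)
qed

text \<open>Extending \<open>s \<mapsto> s s\<^sup>-\<^sup>1\<close>, this is \<open>a \<mapsto> a \<cdot> 1\<close> into \<open>B\<close>, seen inside the algebra.\<close>

definition \<pi> :: "('g list set \<Rightarrow> 'k) \<Rightarrow> 'g list set \<Rightarrow> 'k" where
  "\<pi> = lin_ext K KS (\<lambda>k s. single K k (rng s))"

lemma \<pi>:
  shows \<pi>_closed: "a \<in> carrier KS \<Longrightarrow> \<pi> a \<in> carrier KS"
    and \<pi>_add: "\<lbrakk>a \<in> carrier KS; b \<in> carrier KS\<rbrakk> \<Longrightarrow> \<pi> (a \<oplus>\<^bsub>KS\<^esub> b) = \<pi> a \<oplus>\<^bsub>KS\<^esub> \<pi> b"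
    and \<pi>_single: "\<lbrakk>k \<in> carrier K; s \<in> carrier S\<rbrakk> \<Longrightarrow> \<pi> (single K k s) = single K k (rng s)"
  unfolding \<pi>_def by (rule lin_ext_KS; simp add: R.abelian_group_axioms KS_single_add)+

lemma \<pi>_zero: "\<pi> \<zero>\<^bsub>KS\<^esub> = \<zero>\<^bsub>KS\<^esub>"
  by (simp add: \<pi>_def lin_ext_def zero_KS)

lemma B_single:
  assumes "k \<in> carrier K" "s \<in> carrier S"
  shows "single K k s \<odot>\<^bsub>Kpar_B K G\<^esub> eps p = single K k (rng s)"
  using assms by (simp add: Kpar_B_def eps_p_one alg_basis_single K.bilinear_ext_single rng_def sinv_def)

lemma smult_one_B: "a \<in> carrier KS \<Longrightarrow> a \<odot>\<^bsub>Kpar_B K G\<^esub> eps p = \<pi> a"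
proof (induction rule: KS_induct)
  case zero
  show ?case using eps_p by (simp add: \<pi>_zero) (simp add: Kpar_B_def zero_KS)
next
  case (single k s)
  then show ?case by (simp add: B_single \<pi>_single)
next
  case (add a b)
  then show ?case using eps_p by (simp add: N.smult_l_distr \<pi>_add) (simp add: Kpar_B_def add_KS)
qed

lemma Ann_iff: "a \<in> Ann \<longleftrightarrow> a \<in> carrier KS \<and> \<pi> a = \<zero>\<^bsub>KS\<^esub>"
  by (auto simp: Ann_def smult_one_B) (simp_all add: Kpar_B_def zero_KS)

section \<open>Generators of the annihilator\<close>

definition gen_diff :: "'g \<Rightarrow> 'g list set \<Rightarrow> 'k" where
  "gen_diff g = \<delta> (par_gen G g) \<ominus>\<^bsub>KS\<^esub> \<delta> (par_e G g)"

lemma gen_diff_closed [simp, intro]: "g \<in> carrier G \<Longrightarrow> gen_diff g \<in> carrier KS"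
  by (simp add: gen_diff_def)

lemma gen_diff_add: "g \<in> carrier G \<Longrightarrow> gen_diff g \<oplus>\<^bsub>KS\<^esub> \<delta> (par_e G g) = \<delta> (par_gen G g)"
  by (simp add: gen_diff_def a_minus_def R.a_assoc R.l_neg)

text \<open>Both \<open>[g]\<close> and \<open>e_g\<close> send \<open>1\<close> in \<open>B\<close>
  to \<open>e_g\<close>.\<close>

lemma gen_diff_Ann: assumes "g \<in> carrier G" shows "gen_diff g \<in> Ann"
proof -
  have "gen_diff g \<odot>\<^bsub>Kpar_B K G\<^esub> eps p = \<delta> (par_e G g) \<odot>\<^bsub>Kpar_B K G\<^esub> eps p \<ominus>\<^bsub>Kpar_B K G\<^esub> \<delta> (par_e G g) \<odot>\<^bsub>Kpar_B K G\<^esub> eps p"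
    using assms eps_p by (simp add: gen_diff_def N.smult_l_diff B_single rng_gen rng_of_pidem pidem_e)
  also have "\<dots> = \<zero>\<^bsub>Kpar_B K G\<^esub>"
    using assms eps_p by (simp add: a_minus_def N.M.r_neg N.smult_closed)
  finally show ?thesis using assms by (simp add: Ann_def)
qed

lemma \<delta>_mult: "\<delta> s \<otimes>\<^bsub>KS\<^esub> \<delta> t = \<delta> (s \<otimes>\<^bsub>S\<^esub> t)"
  by (simp add: KS_single_mult)

text \<open>The map \<open>g \<mapsto> [g] - e_g\<close> is itself a partial derivation, and
  homomorphisms on \<open>Ann\<close> carry it to derivations into \<open>M\<close>. The identity
  telescopes: \<open>x - z = (x - y) + (y - z)\<close> with \<open>x = [g][h]\<close>,
  \<open>y = e_gh [g]\<close> and \<open>z = e_gh e_g\<close>.\<close>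

lemma gen_diff_cocycle:
  assumes g: "g \<in> carrier G" and h: "h \<in> carrier G"
  shows "\<delta> (par_e G g) \<otimes>\<^bsub>KS\<^esub> gen_diff (g \<otimes> h) = \<delta> (par_gen G g) \<otimes>\<^bsub>KS\<^esub> gen_diff h \<oplus>\<^bsub>KS\<^esub> \<delta> (par_e G (g \<otimes> h)) \<otimes>\<^bsub>KS\<^esub> gen_diff g"
proof -
  let ?x = "\<delta> (par_gen G g \<otimes>\<^bsub>S\<^esub> par_gen G h)" and ?y = "\<delta> (par_e G (g \<otimes> h) \<otimes>\<^bsub>S\<^esub> par_gen G g)"
    and ?z = "\<delta> (par_e G (g \<otimes> h) \<otimes>\<^bsub>S\<^esub> par_e G g)"
  have c: "?x \<in> carrier KS" "?y \<in> carrier KS" "?z \<in> carrier KS"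
    using g h by auto
  have dist: "a \<otimes>\<^bsub>KS\<^esub> (b \<ominus>\<^bsub>KS\<^esub> c) = a \<otimes>\<^bsub>KS\<^esub> b \<ominus>\<^bsub>KS\<^esub> a \<otimes>\<^bsub>KS\<^esub> c"
    if "a \<in> carrier KS" "b \<in> carrier KS" "c \<in> carrier KS" for a b c
    using that by (simp add: a_minus_def R.r_distr R.r_minus)
  have "\<delta> (par_e G g) \<otimes>\<^bsub>KS\<^esub> gen_diff (g \<otimes> h) = ?x \<ominus>\<^bsub>KS\<^esub> ?z"
    using g h by (simp add: gen_diff_def dist \<delta>_mult S_rel_left e_commute[of g "g \<otimes> h"])
  moreover have "\<delta> (par_gen G g) \<otimes>\<^bsub>KS\<^esub> gen_diff h = ?x \<ominus>\<^bsub>KS\<^esub> ?y"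
    using g h by (simp add: gen_diff_def dist \<delta>_mult gen_e)
  moreover have "\<delta> (par_e G (g \<otimes> h)) \<otimes>\<^bsub>KS\<^esub> gen_diff g = ?y \<ominus>\<^bsub>KS\<^esub> ?z"
    using g h by (simp add: gen_diff_def dist \<delta>_mult)
  moreover have "(?x \<ominus>\<^bsub>KS\<^esub> ?y) \<oplus>\<^bsub>KS\<^esub> (?y \<ominus>\<^bsub>KS\<^esub> ?z) = ?x \<ominus>\<^bsub>KS\<^esub> ?z"
  proof -
    have "(?x \<oplus>\<^bsub>KS\<^esub> \<ominus>\<^bsub>KS\<^esub> ?y) \<oplus>\<^bsub>KS\<^esub> (?y \<oplus>\<^bsub>KS\<^esub> \<ominus>\<^bsub>KS\<^esub> ?z)
        = ?x \<oplus>\<^bsub>KS\<^esub> ((\<ominus>\<^bsub>KS\<^esub> ?y \<oplus>\<^bsub>KS\<^esub> ?y) \<oplus>\<^bsub>KS\<^esub> \<ominus>\<^bsub>KS\<^esub> ?z)"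
      using c by (simp only: R.a_assoc R.a_closed R.a_inv_closed)
    then show ?thesis using c by (simp add: a_minus_def R.l_neg)
  qed
  ultimately show ?thesis by simp
qed

lemma single_diff:
  assumes k: "k \<in> carrier K" and s: "s \<in> carrier S"
  shows "single K k s \<ominus>\<^bsub>KS\<^esub> single K k (rng s) = single K k (rng s) \<otimes>\<^bsub>KS\<^esub> gen_diff (deg s)"
  using assms by (simp add: gen_diff_def a_minus_def R.r_distr R.r_minus KS_single_mult rng_deg)

section \<open>Extension of a partial derivation to the algebra\<close>

lemma act: "par_act K M s m = \<delta> s \<odot>\<^bsub>M\<^esub> m"
  by (simp add: par_act_def alg_basis_single)

lemma par_der_closed: "\<lbrakk>d \<in> par_der K G M; g \<in> carrier G\<rbrakk> \<Longrightarrow> d g \<in> carrier M"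
  by (auto simp: par_der_def)

lemma par_der_mult:
  "\<lbrakk>d \<in> par_der K G M; g \<in> carrier G; h \<in> carrier G\<rbrakk> \<Longrightarrow>
    \<delta> (par_e G g) \<odot>\<^bsub>M\<^esub> d (g \<otimes> h) = \<delta> (par_gen G g) \<odot>\<^bsub>M\<^esub> d h \<oplus>\<^bsub>M\<^esub> \<delta> (par_e G (g \<otimes> h)) \<odot>\<^bsub>M\<^esub> d g"
  by (simp add: par_der_def act)

lemma par_e_one: "par_e G \<one> = \<one>\<^bsub>S\<^esub>"
  using S.l_one[OF S.one_closed] by (simp add: par_e_def one_S)

lemma \<delta>_one_act: "m \<in> carrier M \<Longrightarrow> \<delta> \<one>\<^bsub>S\<^esub> \<odot>\<^bsub>M\<^esub> m = m"
  using M.smult_one[of m] by (simp add: one_KS)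

lemma par_der_one:
  assumes d: "d \<in> par_der K G M" shows "d \<one> = \<zero>\<^bsub>M\<^esub>"
proof -
  have dc: "d \<one> \<in> carrier M" using par_der_closed[OF d] by simp
  then have "d \<one> \<oplus>\<^bsub>M\<^esub> d \<one> = d \<one>"
    using par_der_mult[OF d one_closed one_closed] by (simp add: par_e_one \<delta>_one_act flip: one_S)
  then show ?thesis using dc M.M.add.r_cancel_one by metis
qed

text \<open>For \<open>h = g^-1\<close> the identity reads
  \<open>0 = [g] \<cdot> d(g^-1) + d(g)\<close>, by \<open>par_der_one\<close>. Hence
  \<open>d(g)\<close> is a value of \<open>[g]\<close>, and \<open>e_g [g] = [g]\<close>.\<close>

lemma par_der_e:
  assumes d: "d \<in> par_der K G M" and g: "g \<in> carrier G"
  shows "\<delta> (par_e G g) \<odot>\<^bsub>M\<^esub> d g = d g"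
proof -
  have dc: "d g \<in> carrier M" "d (inv g) \<in> carrier M" using par_der_closed[OF d] g by auto
  have "\<zero>\<^bsub>M\<^esub> = \<delta> (par_gen G g) \<odot>\<^bsub>M\<^esub> d (inv g) \<oplus>\<^bsub>M\<^esub> d g"
    using par_der_mult[OF d g inv_closed[OF g]] g dc
    by (simp add: par_e_one \<delta>_one_act par_der_one[OF d])
  then have "d g = \<ominus>\<^bsub>M\<^esub> (\<delta> (par_gen G g) \<odot>\<^bsub>M\<^esub> d (inv g))"
    using dc g by (intro M.M.minus_equality[symmetric]) (simp_all add: M.smult_closed M.M.a_comm)
  then show ?thesis
    using g dc by (simp add: M.smult_r_minus M.smult_closed M.smult_assoc[symmetric] \<delta>_mult)
qed

text \<open>
  The value \<open>s s\<^sup>-\<^sup>1 \<cdot> d (deg s)\<close> is forced by \<open>s - s s\<^sup>-\<^sup>1 = s s\<^sup>-\<^sup>1 ([g] - e\<^sub>g)\<close> with \<open>g = deg s\<close>.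
\<close>

definition ext_der :: "('g \<Rightarrow> 'm) \<Rightarrow> ('g list set \<Rightarrow> 'k) \<Rightarrow> 'm" where
  "ext_der d = lin_ext K M (\<lambda>k s. single K k (rng s) \<odot>\<^bsub>M\<^esub> d (deg s))"

lemma ext_der:
  assumes d: "d \<in> par_der K G M"
  shows ext_der_closed: "a \<in> carrier KS \<Longrightarrow> ext_der d a \<in> carrier M"
    and ext_der_add: "\<lbrakk>a \<in> carrier KS; b \<in> carrier KS\<rbrakk> \<Longrightarrow> ext_der d (a \<oplus>\<^bsub>KS\<^esub> b) = ext_der d a \<oplus>\<^bsub>M\<^esub> ext_der d b"
    and ext_der_single: "\<lbrakk>k \<in> carrier K; s \<in> carrier S\<rbrakk> \<Longrightarrow>
      ext_der d (single K k s) = single K k (rng s) \<odot>\<^bsub>M\<^esub> d (deg s)"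
  unfolding ext_der_def
  by (rule lin_ext_KS; simp add: M.M.abelian_group_axioms KS_single_add par_der_closed[OF d] M.smult_closed M.smult_l_distr)+

lemma ext_der_zero: "ext_der d \<zero>\<^bsub>KS\<^esub> = \<zero>\<^bsub>M\<^esub>"
  by (simp add: ext_der_def lin_ext_def zero_KS)

text \<open>The derivation identity for \<open>deg t\<close> and \<open>deg s\<close>, multiplied by
  \<open>r = rng (t s)\<close>. The idempotents \<open>e_g\<close> and \<open>e_gh\<close> are
  absorbed by \<open>r\<close>, and \<open>r [g]\<close> becomes
  \<open>r t = t (rng s)\<close>.\<close>

lemma ext_der_single_mult:
  assumes d: "d \<in> par_der K G M" and k: "k \<in> carrier K" and s: "s \<in> carrier S" and t: "t \<in> carrier S"
  shows "single K k (rng (t \<otimes>\<^bsub>S\<^esub> s)) \<odot>\<^bsub>M\<^esub> d (deg t \<otimes> deg s)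
    = single K k (t \<otimes>\<^bsub>S\<^esub> rng s) \<odot>\<^bsub>M\<^esub> d (deg s) \<oplus>\<^bsub>M\<^esub> single K k (rng (t \<otimes>\<^bsub>S\<^esub> s)) \<odot>\<^bsub>M\<^esub> d (deg t)"
proof -
  let ?g = "deg t" and ?h = "deg s" and ?r = "rng (t \<otimes>\<^bsub>S\<^esub> s)"
  have gh: "?g \<in> carrier G" "?h \<in> carrier G" using s t by auto
  have dc: "d ?g \<in> carrier M" "d ?h \<in> carrier M" "d (?g \<otimes> ?h) \<in> carrier M"
    using par_der_closed[OF d] gh by auto
  have r: "?r \<in> carrier S" using s t by auto
  have rt: "?r \<otimes>\<^bsub>S\<^esub> rng t = ?r" using rng_mult_absorb(2)[OF t s] .
  have "?r \<otimes>\<^bsub>S\<^esub> par_e G ?g = ?r \<otimes>\<^bsub>S\<^esub> rng t \<otimes>\<^bsub>S\<^esub> par_e G ?g" by (simp add: rt)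
  also have "\<dots> = ?r \<otimes>\<^bsub>S\<^esub> rng t" using r t gh by (simp add: S.m_assoc rng_deg)
  finally have re: "?r \<otimes>\<^bsub>S\<^esub> par_e G ?g = ?r" by (simp add: rt)
  have "?r \<otimes>\<^bsub>S\<^esub> par_gen G ?g = ?r \<otimes>\<^bsub>S\<^esub> rng t \<otimes>\<^bsub>S\<^esub> par_gen G ?g" by (simp add: rt)
  also have "\<dots> = ?r \<otimes>\<^bsub>S\<^esub> t" using r t gh by (simp add: S.m_assoc rng_deg)
  finally have rg: "?r \<otimes>\<^bsub>S\<^esub> par_gen G ?g = t \<otimes>\<^bsub>S\<^esub> rng s" using rng_mult_absorb(1)[OF t s] by simp
  have regh: "?r \<otimes>\<^bsub>S\<^esub> par_e G (?g \<otimes> ?h) = ?r"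
    using rng_deg(1)[of "t \<otimes>\<^bsub>S\<^esub> s"] s t by simp
  have mult: "single K k ?r \<otimes>\<^bsub>KS\<^esub> \<delta> x = single K k (?r \<otimes>\<^bsub>S\<^esub> x)" for x
    using k by (simp add: KS_single_mult)
  have "single K k ?r \<odot>\<^bsub>M\<^esub> d (?g \<otimes> ?h) = single K k ?r \<odot>\<^bsub>M\<^esub> (\<delta> (par_e G ?g) \<odot>\<^bsub>M\<^esub> d (?g \<otimes> ?h))"
    using k r gh dc by (simp add: M.smult_assoc[symmetric] mult re)
  also have "\<dots> = single K k ?r \<odot>\<^bsub>M\<^esub> (\<delta> (par_gen G ?g) \<odot>\<^bsub>M\<^esub> d ?h)
      \<oplus>\<^bsub>M\<^esub> single K k ?r \<odot>\<^bsub>M\<^esub> (\<delta> (par_e G (?g \<otimes> ?h)) \<odot>\<^bsub>M\<^esub> d ?g)"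
    using k r gh dc by (simp add: par_der_mult[OF d] M.smult_r_distr M.smult_closed)
  also have "\<dots> = single K k (t \<otimes>\<^bsub>S\<^esub> rng s) \<odot>\<^bsub>M\<^esub> d ?h \<oplus>\<^bsub>M\<^esub> single K k ?r \<odot>\<^bsub>M\<^esub> d ?g"
    using k r gh dc by (simp add: M.smult_assoc[symmetric] mult rg regh)
  finally show ?thesis .
qed

text \<open>For \<open>b = l s\<close> the error term is \<open>k l\<close> times
  \<open>rng (t s)\<close>, applied to \<open>d (deg t)\<close>. Writing \<open>rng (t s)\<close> as
  \<open>t (rng s) t^-1\<close> makes it additive in \<open>\<pi> b\<close>, so the formula passes
  to sums.\<close>

lemma ext_der_mult_single:
  assumes d: "d \<in> par_der K G M" and k: "k \<in> carrier K" and t: "t \<in> carrier S" and b: "b \<in> carrier KS"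
  shows "ext_der d (single K k t \<otimes>\<^bsub>KS\<^esub> b) = single K k t \<odot>\<^bsub>M\<^esub> ext_der d b
    \<oplus>\<^bsub>M\<^esub> (single K k t \<otimes>\<^bsub>KS\<^esub> \<pi> b \<otimes>\<^bsub>KS\<^esub> \<delta> (sinv t)) \<odot>\<^bsub>M\<^esub> d (deg t)"
proof -
  have x: "single K k t \<in> carrier KS" "\<delta> (sinv t) \<in> carrier KS" "d (deg t) \<in> carrier M"
    using k t par_der_closed[OF d] by auto
  show ?thesis
    using b
  proof (induction rule: KS_induct)
    case zero
    then show ?case using x by (simp add: ext_der_zero \<pi>_zero)
  next
    case (single l s)
    then have "d (deg s) \<in> carrier M" using par_der_closed[OF d] by auto
    then show ?case
      using single k t x ext_der_single_mult[OF d, of "k \<otimes>\<^bsub>K\<^esub> l" s t]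
      by (simp add: ext_der_single[OF d] KS_single_mult \<pi>_single M.smult_assoc[symmetric] rng_mult)
  next
    case (add a b)
    let ?x = "single K k t" and ?y = "\<delta> (sinv t)" and ?m = "d (deg t)"
    have c: "?x \<odot>\<^bsub>M\<^esub> ext_der d a \<in> carrier M" "?x \<odot>\<^bsub>M\<^esub> ext_der d b \<in> carrier M"
      "(?x \<otimes>\<^bsub>KS\<^esub> \<pi> a \<otimes>\<^bsub>KS\<^esub> ?y) \<odot>\<^bsub>M\<^esub> ?m \<in> carrier M" "(?x \<otimes>\<^bsub>KS\<^esub> \<pi> b \<otimes>\<^bsub>KS\<^esub> ?y) \<odot>\<^bsub>M\<^esub> ?m \<in> carrier M"
      using add x by (simp_all add: M.smult_closed ext_der_closed[OF d] \<pi>_closed)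
    have "ext_der d (?x \<otimes>\<^bsub>KS\<^esub> (a \<oplus>\<^bsub>KS\<^esub> b)) = ext_der d (?x \<otimes>\<^bsub>KS\<^esub> a) \<oplus>\<^bsub>M\<^esub> ext_der d (?x \<otimes>\<^bsub>KS\<^esub> b)"
      using add x by (simp add: R.r_distr ext_der_add[OF d])
    moreover have "?x \<odot>\<^bsub>M\<^esub> ext_der d (a \<oplus>\<^bsub>KS\<^esub> b) = ?x \<odot>\<^bsub>M\<^esub> ext_der d a \<oplus>\<^bsub>M\<^esub> ?x \<odot>\<^bsub>M\<^esub> ext_der d b"
      using add x by (simp add: ext_der_add[OF d] M.smult_r_distr ext_der_closed[OF d])
    moreover have "(?x \<otimes>\<^bsub>KS\<^esub> \<pi> (a \<oplus>\<^bsub>KS\<^esub> b) \<otimes>\<^bsub>KS\<^esub> ?y) \<odot>\<^bsub>M\<^esub> ?m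
        = (?x \<otimes>\<^bsub>KS\<^esub> \<pi> a \<otimes>\<^bsub>KS\<^esub> ?y) \<odot>\<^bsub>M\<^esub> ?m \<oplus>\<^bsub>M\<^esub> (?x \<otimes>\<^bsub>KS\<^esub> \<pi> b \<otimes>\<^bsub>KS\<^esub> ?y) \<odot>\<^bsub>M\<^esub> ?m"
      using add x by (simp add: \<pi>_add \<pi>_closed R.r_distr R.l_distr M.smult_l_distr)
    ultimately show ?case using add.IH c by (simp add: M.M.a_ac)
  qed
qed

lemma ext_der_Ann:
  assumes d: "d \<in> par_der K G M" and b: "b \<in> Ann" and a: "a \<in> carrier KS"
  shows "ext_der d (a \<otimes>\<^bsub>KS\<^esub> b) = a \<odot>\<^bsub>M\<^esub> ext_der d b"
proof -
  have bc: "b \<in> carrier KS" and b0: "\<pi> b = \<zero>\<^bsub>KS\<^esub>" using b by (auto simp: Ann_iff)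
  have eb: "ext_der d b \<in> carrier M" using ext_der_closed[OF d bc] .
  show ?thesis
    using a
  proof (induction rule: KS_induct)
    case zero
    then show ?case using bc eb by (simp add: ext_der_zero)
  next
    case (single k t)
    then show ?case
      using bc eb par_der_closed[OF d] by (simp add: ext_der_mult_single[OF d] b0 M.smult_closed)
  next
    case (add a a')
    then show ?case using bc eb by (simp add: R.l_distr ext_der_add[OF d] M.smult_l_distr)
  qed
qed

text \<open>The extension vanishes on \<open>e_g\<close>, whose degree is \<open>1\<close>, and
  gives \<open>e_g \<cdot> d(g) = d(g)\<close> on \<open>[g]\<close>.\<close>

lemma ext_der_gen_diff:
  assumes d: "d \<in> par_der K G M" and g: "g \<in> carrier G"
  shows "ext_der d (gen_diff g) = d g"
proof -
  have "ext_der d (gen_diff g) = ext_der d (gen_diff g) \<oplus>\<^bsub>M\<^esub> ext_der d (\<delta> (par_e G g))"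
    using g ext_der_closed[OF d]
    by (simp add: ext_der_single[OF d] deg_pidem pidem_e par_der_one[OF d])
  also have "\<dots> = ext_der d (\<delta> (par_gen G g))"
    using g by (simp add: ext_der_add[OF d, symmetric] gen_diff_add)
  also have "\<dots> = d g"
    using g by (simp add: ext_der_single[OF d] rng_gen par_der_e[OF d])
  finally show ?thesis .
qed

lemma par_der_pointwise: "comm_group (pointwise_group (carrier G) M (par_der K G M))"
proof (rule M.M.pointwise_comm_group)
  show "par_der K G M \<subseteq> carrier G \<rightarrow>\<^sub>E carrier M" by (auto simp: par_der_def)
  show "(\<lambda>x\<in>carrier G. \<zero>\<^bsub>M\<^esub>) \<in> par_der K G M"
    by (auto simp: par_der_def act)
  show "(\<lambda>x\<in>carrier G. f x \<oplus>\<^bsub>M\<^esub> h x) \<in> par_der K G M" if f: "f \<in> par_der K G M" and h: "h \<in> par_der K G M" for f h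
    using par_der_closed[OF f] par_der_closed[OF h]
    by (auto simp: par_der_def act M.smult_r_distr M.smult_closed par_der_mult[OF f] par_der_mult[OF h] M.M.a_ac)
  show "(\<lambda>x\<in>carrier G. \<ominus>\<^bsub>M\<^esub> f x) \<in> par_der K G M" if f: "f \<in> par_der K G M" for f
    using par_der_closed[OF f]
    by (auto simp: par_der_def act M.smult_r_minus M.smult_closed par_der_mult[OF f] M.M.minus_add)
qed

section \<open>Homomorphisms on the annihilator against partial derivations\<close>

definition gen_map :: "(('g list set \<Rightarrow> 'k) \<Rightarrow> 'm) \<Rightarrow> 'g \<Rightarrow> 'm" where
  "gen_map \<phi> = (\<lambda>g\<in>carrier G. \<phi> (gen_diff g))"

lemma gen_map_closed: assumes \<phi>: "\<phi> \<in> hom_Ann" shows "gen_map \<phi> \<in> par_der K G M"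
proof -
  have "\<delta> (par_e G g) \<odot>\<^bsub>M\<^esub> \<phi> (gen_diff (g \<otimes> h)) =
      \<delta> (par_gen G g) \<odot>\<^bsub>M\<^esub> \<phi> (gen_diff h) \<oplus>\<^bsub>M\<^esub> \<delta> (par_e G (g \<otimes> h)) \<odot>\<^bsub>M\<^esub> \<phi> (gen_diff g)"
    if g: "g \<in> carrier G" and h: "h \<in> carrier G" for g h
    using arg_cong[OF gen_diff_cocycle[OF g h], of \<phi>] g h
    by (simp add: hom_AnnD[OF \<phi>] gen_diff_Ann Ann_mult)
  then show ?thesis
    by (auto simp: par_der_def gen_map_def act hom_AnnD[OF \<phi>] gen_diff_Ann)
qed

lemma gen_map_hom: "gen_map \<in> hom (pointwise_group Ann M hom_Ann) (pointwise_group (carrier G) M (par_der K G M))"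
proof (rule homI)
  show "gen_map \<phi> \<in> carrier (pointwise_group (carrier G) M (par_der K G M))"
    if "\<phi> \<in> carrier (pointwise_group Ann M hom_Ann)" for \<phi>
    using that by (simp add: pointwise_group_def gen_map_closed)
qed (auto simp: pointwise_group_def gen_map_def gen_diff_Ann intro!: restrict_ext)

lemma gen_map_surj:
  assumes d: "d \<in> par_der K G M" shows "\<exists>\<phi>\<in>hom_Ann. gen_map \<phi> = d"
proof
  show "(\<lambda>a\<in>Ann. ext_der d a) \<in> hom_Ann"
    by (auto simp: hom_Ann_def Ann_add Ann_mult Ann_closed ext_der_closed[OF d] ext_der_add[OF d]
        ext_der_Ann[OF d])
  show "gen_map (\<lambda>a\<in>Ann. ext_der d a) = d"
    using d by (intro extensionalityI[of _ "carrier G"]) (auto simp: gen_map_def gen_diff_Ann ext_der_gen_diff par_der_def PiE_def)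
qed

lemma inner_act:
  "\<lbrakk>g \<in> carrier G; m \<in> carrier M\<rbrakk> \<Longrightarrow>
    par_act K M (par_gen G g) m \<ominus>\<^bsub>M\<^esub> par_act K M (par_e G g) m = gen_diff g \<odot>\<^bsub>M\<^esub> m"
  by (simp add: act gen_diff_def M.smult_l_diff)

lemma par_inner_der_eq: "par_inner_der K G M = (\<lambda>m. \<lambda>g\<in>carrier G. gen_diff g \<odot>\<^bsub>M\<^esub> m) ` carrier M"
proof
  show "par_inner_der K G M \<subseteq> (\<lambda>m. \<lambda>g\<in>carrier G. gen_diff g \<odot>\<^bsub>M\<^esub> m) ` carrier M"
  proof
    fix d assume "d \<in> par_inner_der K G M"
    then obtain m where m: "m \<in> carrier M" and d: "d \<in> extensional (carrier G)"
      "\<And>g. g \<in> carrier G \<Longrightarrow> d g = gen_diff g \<odot>\<^bsub>M\<^esub> m"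
      by (auto simp: par_inner_der_def PiE_def inner_act)
    then have "d = (\<lambda>g\<in>carrier G. gen_diff g \<odot>\<^bsub>M\<^esub> m)"
      by (intro extensionalityI[of _ "carrier G"]) auto
    then show "d \<in> (\<lambda>m. \<lambda>g\<in>carrier G. gen_diff g \<odot>\<^bsub>M\<^esub> m) ` carrier M" using m by blast
  qed
  show "(\<lambda>m. \<lambda>g\<in>carrier G. gen_diff g \<odot>\<^bsub>M\<^esub> m) ` carrier M \<subseteq> par_inner_der K G M"
    by (auto simp: par_inner_der_def inner_act M.smult_closed)
qed

lemma gen_map_inner: "gen_map ` inner_Ann = par_inner_der K G M"
proof -
  have "gen_map (\<lambda>a\<in>Ann. a \<odot>\<^bsub>M\<^esub> m) = (\<lambda>g\<in>carrier G. gen_diff g \<odot>\<^bsub>M\<^esub> m)" for m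
    by (auto simp: gen_map_def gen_diff_Ann intro!: restrict_ext)
  then show ?thesis by (simp add: inner_Ann_def par_inner_der_eq image_image)
qed

text \<open>The set \<open>T\<close> where the two maps agree is closed under addition and left
  multiplication and contains the generators. It remains to see that every \<open>a\<close> in
  \<open>Ann\<close> is a combination of them, using \<open>a = a - \<pi> a\<close>.\<close>

lemma inner_on_generators:
  assumes \<phi>: "\<phi> \<in> hom_Ann" and m: "m \<in> carrier M"
    and gen: "\<And>g. g \<in> carrier G \<Longrightarrow> \<phi> (gen_diff g) = gen_diff g \<odot>\<^bsub>M\<^esub> m" and a: "a \<in> Ann"
  shows "\<phi> a = a \<odot>\<^bsub>M\<^esub> m"
proof -
  define T where "T = {x \<in> Ann. \<phi> x = x \<odot>\<^bsub>M\<^esub> m}"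
  have T_add: "x \<oplus>\<^bsub>KS\<^esub> y \<in> T" if "x \<in> T" "y \<in> T" for x y
    using that m by (simp add: T_def hom_AnnD[OF \<phi>] Ann_add Ann_closed M.smult_l_distr)
  have T_mult: "x \<otimes>\<^bsub>KS\<^esub> y \<in> T" if "x \<in> carrier KS" "y \<in> T" for x y
    using that m by (simp add: T_def hom_AnnD[OF \<phi>] Ann_mult Ann_closed M.smult_assoc)
  have T_gen_diff: "gen_diff g \<in> T" if "g \<in> carrier G" for g
    using that by (simp add: T_def gen_diff_Ann gen)
  \<comment> \<open>Stated for all of \<open>KS\<close>, because induction along the support leaves
    \<open>Ann\<close>; for a single \<open>s\<close> the difference is a multiple of a generator by
    \<open>single_diff\<close>.\<close>
  have "x \<ominus>\<^bsub>KS\<^esub> \<pi> x \<in> T" if "x \<in> carrier KS" for x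
    using that
  proof (induction rule: KS_induct)
    case zero
    have "\<zero>\<^bsub>KS\<^esub> \<otimes>\<^bsub>KS\<^esub> gen_diff \<one> \<in> T" by (intro T_mult T_gen_diff) auto
    then show ?case by (simp add: \<pi>_zero a_minus_def)
  next
    case (single k s)
    then show ?case by (simp add: \<pi>_single single_diff T_mult T_gen_diff)
  next
    case (add a b)
    then have "(a \<oplus>\<^bsub>KS\<^esub> b) \<ominus>\<^bsub>KS\<^esub> \<pi> (a \<oplus>\<^bsub>KS\<^esub> b) = (a \<ominus>\<^bsub>KS\<^esub> \<pi> a) \<oplus>\<^bsub>KS\<^esub> (b \<ominus>\<^bsub>KS\<^esub> \<pi> b)"
      by (simp add: \<pi>_add \<pi>_closed a_minus_def R.minus_add R.a_ac)
    then show ?case using add T_add by simp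
  qed
  then have "a \<ominus>\<^bsub>KS\<^esub> \<pi> a \<in> T" using a by (simp add: Ann_closed)
  then show ?thesis using a by (simp add: Ann_iff T_def a_minus_def)
qed

lemma gen_map_ker:
  assumes \<phi>: "\<phi> \<in> hom_Ann" shows "gen_map \<phi> \<in> par_inner_der K G M \<longleftrightarrow> \<phi> \<in> inner_Ann"
proof
  assume "gen_map \<phi> \<in> par_inner_der K G M"
  then obtain m where m: "m \<in> carrier M" and eq: "gen_map \<phi> = (\<lambda>g\<in>carrier G. gen_diff g \<odot>\<^bsub>M\<^esub> m)"
    by (auto simp: par_inner_der_eq)
  have "\<phi> (gen_diff g) = gen_diff g \<odot>\<^bsub>M\<^esub> m" if "g \<in> carrier G" for g
    using fun_cong[OF eq, of g] that by (simp add: gen_map_def)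
  then have "\<phi> a = a \<odot>\<^bsub>M\<^esub> m" if "a \<in> Ann" for a
    using inner_on_generators[OF \<phi> m] that by blast
  then have "\<phi> = (\<lambda>a\<in>Ann. a \<odot>\<^bsub>M\<^esub> m)"
    using \<phi> by (intro extensionalityI[of _ Ann]) (auto simp: hom_Ann_def PiE_def)
  then show "\<phi> \<in> inner_Ann" using m by (auto simp: inner_Ann_def)
next
  assume "\<phi> \<in> inner_Ann"
  then show "gen_map \<phi> \<in> par_inner_der K G M" using gen_map_inner by blast
qed

lemma par_der_iso:
  "pointwise_group Ann M hom_Ann Mod inner_Ann \<cong>
    pointwise_group (carrier G) M (par_der K G M) Mod par_inner_der K G M"
proof (rule FactGroup_isoI[OF _ par_der_pointwise _ gen_map_hom])
  interpret H: comm_group "pointwise_group Ann M hom_Ann" by (rule hom_Ann_pointwise)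
  interpret D: comm_group "pointwise_group (carrier G) M (par_der K G M)" by (rule par_der_pointwise)
  interpret group_hom "pointwise_group Ann M hom_Ann" "pointwise_group (carrier G) M (par_der K G M)" gen_map
    by unfold_locales (rule gen_map_hom)
  show "group (pointwise_group Ann M hom_Ann)" by (rule H.group_axioms)
  show sub: "subgroup (par_inner_der K G M) (pointwise_group (carrier G) M (par_der K G M))"
    using subgroup_img_is_subgroup[OF inner_Ann_subgroup] by (simp add: gen_map_inner)
  show "\<exists>z\<in>carrier (pointwise_group Ann M hom_Ann). \<exists>b\<in>par_inner_der K G M.
      x = b \<otimes>\<^bsub>pointwise_group (carrier G) M (par_der K G M)\<^esub> gen_map z"
    if x: "x \<in> carrier (pointwise_group (carrier G) M (par_der K G M))" for x
  proof -
    obtain \<phi> where "\<phi> \<in> hom_Ann" "gen_map \<phi> = x"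
      using x gen_map_surj by (auto simp: pointwise_group_def)
    \<comment> \<open>Here \<open>gen_map\<close> itself is onto, so the inner factor is the neutral
      element.\<close>
    then show ?thesis
      using x subgroup.one_closed[OF sub] D.l_one[OF x] by (auto simp: pointwise_group_def[of Ann] intro!: bexI)
  qed
  show "inner_Ann \<subseteq> carrier (pointwise_group Ann M hom_Ann)"
    using inner_Ann_subgroup by (rule subgroup.subset)
qed (simp add: pointwise_group_def gen_map_ker)

end

text \<open>The axioms come from \<open>P\<close> through \<open>eps\<close>. What is left is
  \<open>eps 0 = 0\<close>, which follows from additivity by cancelling in \<open>K\<close> at each
  point.\<close>

lemma left_module_Kpar_B:
  assumes K: "cring K" and P: "left_module (Kpar K G) P"
    and eps: "eps \<in> lmod_hom (Kpar K G) P (Kpar_B K G)" and im: "eps ` carrier P = carrier (Kpar_B K G)"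
  shows "left_module (Kpar K G) (Kpar_B K G)"
proof (rule left_module_image[OF P eps im])
  interpret K: cring K by fact
  interpret P: left_module "Kpar K G" P by fact
  have "eps \<zero>\<^bsub>P\<^esub> x = \<zero>\<^bsub>K\<^esub>" for x
  proof -
    have "eps \<zero>\<^bsub>P\<^esub> \<in> carrier (Kpar_B K G)" using lmod_hom_closed[OF eps P.M.zero_closed] .
    then have c: "eps \<zero>\<^bsub>P\<^esub> x \<in> carrier K"
      by (cases "x \<in> idempotents (par_monoid G)") (auto simp: Kpar_B_def fin_supp_funs_def)
    have "eps \<zero>\<^bsub>P\<^esub> = eps \<zero>\<^bsub>P\<^esub> \<oplus>\<^bsub>Kpar_B K G\<^esub> eps \<zero>\<^bsub>P\<^esub>"
      using lmod_hom_add[OF eps P.M.zero_closed P.M.zero_closed] by simp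
    then have "eps \<zero>\<^bsub>P\<^esub> x \<oplus>\<^bsub>K\<^esub> eps \<zero>\<^bsub>P\<^esub> x = eps \<zero>\<^bsub>P\<^esub> x"
      by (metis (no_types) Kpar_B_def ring_record_simps(12))
    then show ?thesis using c K.add.r_cancel_one by metis
  qed
  then show "eps \<zero>\<^bsub>P\<^esub> = \<zero>\<^bsub>Kpar_B K G\<^esub>" by (auto simp: Kpar_B_def)
qed

section \<open>The isomorphism for an arbitrary projective resolution\<close>

theorem theorem2p6:
  fixes K :: "('k, 'a) ring_scheme"
    and G :: "('g, 'b) monoid_scheme"
    and M :: "('g list set \<Rightarrow> 'k, 'm) module"
    and P :: "nat \<Rightarrow> ('g list set \<Rightarrow> 'k, 'p) module"
    and d :: "nat \<Rightarrow> 'p \<Rightarrow> 'p"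
    and eps :: "'p \<Rightarrow> ('g list set \<Rightarrow> 'k)"
  assumes "cring K"
    and "group G"
    and "left_module (Kpar K G) M"
    and "projective_resolution (Kpar K G) (Kpar_B K G) P d eps"
  shows "Ext (Kpar K G) P d M 1 \<cong>
    pointwise_group (carrier G) M (par_der K G M) Mod par_inner_der K G M"
proof -
  let ?R = "Kpar K G" and ?B = "Kpar_B K G" and ?one = "alg_basis K \<one>\<^bsub>par_monoid G\<^esub>"
  interpret K: cring K by fact
  interpret par_group G using assms(2) by (simp add: par_group_def)
  have proj: "projective_lmod ?R (P n)" for n
    using assms(4) by (simp add: projective_resolution_def)
  have P: "left_module ?R (P n)" for n
    using proj[of n] by (simp add: projective_lmod_def)
  have d: "d n \<in> lmod_hom ?R (P (Suc n)) (P n)" for n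
    using assms(4) by (simp add: projective_resolution_def)
  have eps: "eps \<in> lmod_hom ?R (P 0) ?B" and eps_im: "eps ` carrier (P 0) = carrier ?B"
    and exact0: "d 0 ` carrier (P 1) = {x \<in> carrier (P 0). eps x = \<zero>\<^bsub>?B\<^esub>}"
    and exact1: "d (Suc 0) ` carrier (P (Suc (Suc 0))) = {x \<in> carrier (P (Suc 0)). d 0 x = \<zero>\<^bsub>P 0\<^esub>}"
    using assms(4) by (auto simp: projective_resolution_def)
  have B: "left_module ?R ?B"
    using assms(1) P eps eps_im by (rule left_module_Kpar_B)
  interpret B: left_module ?R ?B by (rule B)
  have one_B: "?one \<in> carrier ?B"
    by (simp add: Kpar_B_def alg_basis_single K.single_closed idempotents_S pidem.one)
  then obtain p where p: "p \<in> carrier (P 0)" "eps p = ?one"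
    using eps_im by (metis imageE)
  \<comment> \<open>The coefficient is \<open>b\<close> itself, read as an element of the algebra:
    its support consists of idempotents, and \<open>e \<cdot> 1 = e e^-1 = e\<close> gives
    \<open>b \<cdot> 1 = b\<close>.\<close>
  have cyc: "\<exists>a\<in>carrier ?R. b = a \<odot>\<^bsub>?B\<^esub> eps p" if "b \<in> carrier ?B" for b
  proof (intro bexI)
    have "b \<in> fin_supp_funs K pidem" using that by (simp add: Kpar_B_def idempotents_S)
    then show "b \<in> carrier ?R"
      by (auto simp: monoid_algebra_def fin_supp_funs_def)
    show "b = b \<odot>\<^bsub>?B\<^esub> eps p"
      using \<open>b \<in> fin_supp_funs K pidem\<close>
    proof (induction rule: K.fin_supp_induct)
      case zero
      show ?case using B.smult_l_zero[OF one_B] by (simp add: p monoid_algebra_def Kpar_B_def)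
    next
      case (single k e)
      then show ?case
        using rng_of_pidem[of e]
        by (simp add: p Kpar_B_def alg_basis_single K.bilinear_ext_single rng_def sinv_def)
    next
      case (add a b)
      have "a \<in> carrier ?R" "b \<in> carrier ?R" using add(1,2)
        by (auto simp: monoid_algebra_def fin_supp_funs_def)
      then have "(a \<oplus>\<^bsub>?R\<^esub> b) \<odot>\<^bsub>?B\<^esub> ?one = a \<odot>\<^bsub>?B\<^esub> ?one \<oplus>\<^bsub>?B\<^esub> b \<odot>\<^bsub>?B\<^esub> ?one"
        using one_B by (rule B.smult_l_distr)
      also have "\<dots> = a \<oplus>\<^bsub>?B\<^esub> b" using add(3,4) by (simp add: p)
      finally show ?case by (simp add: p monoid_algebra_def Kpar_B_def)
    qed
  qed
  have "\<exists>a\<in>carrier ?R. eps x = a \<odot>\<^bsub>?B\<^esub> eps p" if "x \<in> carrier (P 0)" for x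
    using cyc lmod_hom_closed[OF eps that] .
  then obtain \<beta> where \<beta>: "\<And>x. x \<in> carrier (P 0) \<Longrightarrow> \<beta> x \<in> carrier ?R"
    "\<And>x y. \<lbrakk>x \<in> carrier (P 0); y \<in> carrier (P 0)\<rbrakk> \<Longrightarrow> \<beta> (x \<oplus>\<^bsub>P 0\<^esub> y) = \<beta> x \<oplus>\<^bsub>?R\<^esub> \<beta> y"
    "\<And>a x. \<lbrakk>a \<in> carrier ?R; x \<in> carrier (P 0)\<rbrakk> \<Longrightarrow> \<beta> (a \<odot>\<^bsub>P 0\<^esub> x) = a \<otimes>\<^bsub>?R\<^esub> \<beta> x"
    "\<And>x. x \<in> carrier (P 0) \<Longrightarrow> \<beta> x \<odot>\<^bsub>?B\<^esub> eps p = eps x"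
    using projective_lift_cyclic[OF proj B eps p(1)] by metis
  interpret par_presentation K G M "P 0" "P (Suc 0)" "P (Suc (Suc 0))" "d 0" "d (Suc 0)" eps p \<beta>
    by (intro par_presentation.intro cyclic_presentation.intro par_presentation_axioms.intro
        cyclic_presentation_axioms.intro par_group_axioms K.cring_axioms B.R.ring_axioms assms(3) B P d eps
        exact0[unfolded One_nat_def] exact1 p \<beta>)
  have Z: "ext_cocycles ?R P d M (Suc 0) = cocycles"
    by (auto simp: ext_cocycles_def cochains_def coboundary_def cocycles_def restrict_def fun_eq_iff split: if_splits)
  have B: "ext_coboundaries ?R P d M (Suc 0) = coboundaries"
    by (simp add: cochains_def coboundary_def coboundaries_def)
  show ?thesis
    using iso_trans[OF Ext_1_iso par_der_iso] by (simp add: Ext_def Z B del: ext_coboundaries.simps)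
qed

end
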